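(* Let $\mathfrak{X}$ be an abstract AL space, let $(\mathcal{A},\mathcal{D}(\mathcal{A}))$ be a resolvent positive operator on $\mathfrak{X}$ and let $\mathcal{B}\colon\mathcal{D}(\mathcal{A})\to\mathfrak{X}$ be a positive operator such that $$\alpha(\mathcal{A}u+\mathcal{B}u)\le 0\quad\text{for all }u\in\mathcal{D}(\mathcal{A})_+ .$$ Then there exists a substochastic semigroup $\{\mathcal{P}(t)\}_{t\ge 0}$ on $\mathfrak{X}_0=\overline{\mathcal{D}(\mathcal{A})}$ whose generator $(\mathcal{G},\mathcal{D}(\mathcal{G}))$ is an extension of the part $(\mathcal{A}+\mathcal{B})_{|}$ of $(\mathcal{A}+\mathcal{B},\mathcal{D}(\mathcal{A}))$ in $\mathfrak{X}_0$, i.e. $$\mathcal{G}u=\mathcal{A}u+\mathcal{B}u\quad\text{for }u\in\mathcal{D}((\mathcal{A}+\mathcal{B})_{|})=\{u\in\mathcal{D}(\mathcal{A}):\mathcal{A}u+\mathcal{B}u\in\mathfrak{X}_0\}$$ and $\mathcal{D}((\mathcal{A}+\mathcal{B})_{|})\subseteq\mathcal{D}(\mathcal{G})$. The resolvent operator of $\mathcal{G}$ at $\lambda>0$ is given by $$R(\lambda,\mathcal{G})u=\lim_{N\to\infty}\sum_{n=0}^{N}R(\lambda,\mathcal{A})(\mathcal{B}R(\lambda,\mathcal{A}))^n u,\quad u\in\mathfrak{X}_0 .$$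
   Context: An abstract AL space $\mathfrak{X}$ is a (real) Banach lattice whose norm is additive on the positive cone $\mathfrak{X}_+$: $\|u+v\|=\|u\|+\|v\|$ for $u,v\in\mathfrak{X}_+$. $\alpha\colon\mathfrak{X}\to\mathbb{R}$ is the unique positive functional with $\alpha(u)=\|u\|$ for $u\in\mathfrak{X}_+$. For a linear operator $(\mathcal{A},\mathcal{D}(\mathcal{A}))$ on $\mathfrak{X}$ (not necessarily densely defined), $\mathcal{D}(\mathcal{A})_+:=\mathcal{D}(\mathcal{A})\cap\mathfrak{X}_+$. A linear operator defined on $\mathcal{D}(\mathcal{A})$ is positive if it maps $\mathcal{D}(\mathcal{A})_+$ into $\mathfrak{X}_+$. A real $\lambda$ is in the resolvent set $\rho(\mathcal{A})$ if $\lambda-\mathcal{A}\colon\mathcal{D}(\mathcal{A})\to\mathfrak{X}$ is bijective with bounded inverse $R(\lambda,\mathcal{A}):=(\lambda-\mathcal{A})^{-1}$. $\mathcal{A}$ is resolvent positive if there is $\omega\in\mathbb{R}$ with $(\omega,\infty)\subseteq\rho(\mathcal{A})$ and $R(\lambda,\mathcal{A})$ positive for all $\lambda>\omega$. (Under the hypotheses of the claim, $(0,\infty)\subseteq\rho(\mathcal{A})$.) A substochastic semigroup on a closed subspace $\mathfrak{X}_0$ of $\mathfrak{X}$ is a $C_0$-semigroup $\{\mathcal{S}(t)\}_{t\ge0}$ of bounded linear operators on $\mathfrak{X}_0$ such that each $\mathcal{S}(t)$ is positive and $\|\mathcal{S}(t)u\|\le\|u\|$ for $u\in\mathfrak{X}_0\cap\mathfrak{X}_+$.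 *)

theory Defs
  imports "HOL-Analysis.Analysis" "HOL-Library.Lattice_Algebras"
begin

section \<open>Abstract AL spaces\<close>

class banach_lattice = banach + ordered_real_vector + lattice_ab_group_add_abs +
  assumes norm_abs_mono: "\<bar>x\<bar> \<le> \<bar>y\<bar> \<Longrightarrow> norm x \<le> norm y"

class al_space = banach_lattice +
  assumes norm_add_nonneg: "0 \<le> x \<Longrightarrow> 0 \<le> y \<Longrightarrow> norm (x + y) = norm x + norm y"

instance real :: lattice_ab_group_add_abs
  by standard (auto simp: sup_real_def)

instance real :: al_space
  by standard auto

definition al_functional :: "'a::al_space \<Rightarrow> real" where
  "al_functional = (THE f. bounded_linear f \<and> (\<forall>u\<ge>0. 0 \<le> f u) \<and> (\<forall>u\<ge>0. f u = norm u))"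

lemma banach_lattice_norm_abs: "norm \<bar>x\<bar> = norm (x::'a::banach_lattice)"
  by (intro antisym norm_abs_mono) auto

lemma ex1_al_functional:
  "\<exists>!f. bounded_linear f \<and> (\<forall>u\<ge>0. 0 \<le> f u) \<and> (\<forall>u\<ge>0. f u = norm (u::'a::al_space))"
proof (rule ex_ex1I)
  define f where "f = (\<lambda>u::'a. norm (pprt u) - norm (nprt u))"
  have diff: "f (a - b) = norm a - norm b" if "0 \<le> a" "0 \<le> b" for a b :: 'a
  proof -
    have "pprt (a - b) + b = a + - nprt (a - b)"
      using prts[of "a - b"] by (simp add: algebra_simps)
    then have "norm (pprt (a - b) + b) = norm (a + - nprt (a - b))" by simp
    moreover have "norm (pprt (a - b) + b) = norm (pprt (a - b)) + norm b"
      using that by (intro norm_add_nonneg) auto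
    moreover have "norm (a + - nprt (a - b)) = norm a + norm (- nprt (a - b))"
      using that by (intro norm_add_nonneg) auto
    ultimately show ?thesis by (simp add: f_def)
  qed
  have split: "u = pprt u - (- nprt u)" for u :: 'a
    using prts[of u] by simp
  have pos: "f u = norm u" if "0 \<le> u" for u
    using diff[of u 0] that by simp
  have add: "f (u + v) = f u + f v" for u v
  proof -
    have "u + v = (pprt u + pprt v) - (- nprt u + - nprt v)"
      by (subst prts[of u], subst prts[of v]) (simp add: algebra_simps)
    then have "f (u + v) = norm (pprt u + pprt v) - norm (- nprt u + - nprt v)"
      by (simp only:) (intro diff add_nonneg_nonneg, simp_all)
    also have "\<dots> = f u + f v"
      using norm_add_nonneg[of "pprt u" "pprt v"] norm_add_nonneg[of "- nprt u" "- nprt v"]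
      by (simp add: f_def)
    finally show ?thesis .
  qed
  have neg: "f (- u) = - f u" for u
    using add[of u "- u"] pos[of 0] by simp
  have scale_nonneg: "f (c *\<^sub>R u) = c * f u" if "0 \<le> c" for c u
  proof -
    have "c *\<^sub>R u = c *\<^sub>R pprt u - c *\<^sub>R (- nprt u)"
      by (metis scaleR_right_diff_distrib split)
    then have "f (c *\<^sub>R u) = norm (c *\<^sub>R pprt u) - norm (c *\<^sub>R (- nprt u))"
      using diff[of "c *\<^sub>R pprt u" "c *\<^sub>R (- nprt u)"] that
      by (metis neg_0_le_iff_le nprt_le_zero scaleR_nonneg_nonneg zero_le_pprt)
    then show ?thesis using that by (simp add: f_def right_diff_distrib)
  qed
  have scale: "f (c *\<^sub>R u) = c * f u" for c u
  proof (cases "0 \<le> c")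
    case False
    then have "f ((- c) *\<^sub>R u) = (- c) * f u" by (intro scale_nonneg) simp
    then show ?thesis using neg[of "c *\<^sub>R u"] by simp
  qed (rule scale_nonneg)
  have bound: "norm (f u) \<le> norm u * 1" for u
  proof -
    have "\<bar>f u\<bar> \<le> norm (pprt u) + norm (- nprt u)"
      by (simp add: f_def abs_le_iff)
    also have "\<dots> = norm (pprt u + - nprt u)"
      by (rule norm_add_nonneg[symmetric]) auto
    also have "pprt u + - nprt u = \<bar>u\<bar>" by (simp add: abs_prts)
    finally show ?thesis by (simp add: banach_lattice_norm_abs)
  qed
  have "bounded_linear f"
    by (rule bounded_linear_intro[of f 1]) (auto simp: add scale bound[simplified])
  then show "\<exists>f. bounded_linear f \<and> (\<forall>u\<ge>0. 0 \<le> f u) \<and> (\<forall>u\<ge>0. f u = norm (u::'a))"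
    using pos by auto
next
  fix f g :: "'a \<Rightarrow> real"
  assume f: "bounded_linear f \<and> (\<forall>u\<ge>0. 0 \<le> f u) \<and> (\<forall>u\<ge>0. f u = norm u)"
    and g: "bounded_linear g \<and> (\<forall>u\<ge>0. 0 \<le> g u) \<and> (\<forall>u\<ge>0. g u = norm u)"
  interpret f: bounded_linear f using f by simp
  interpret g: bounded_linear g using g by simp
  show "f = g"
  proof
    fix u :: 'a
    have "u = pprt u - (- nprt u)" using prts[of u] by simp
    moreover have "f (pprt u) = g (pprt u)" "f (- nprt u) = g (- nprt u)"
      using f g by simp_all
    ultimately show "f u = g u" by (metis f.diff g.diff)
  qed
qed

lemma al_functional:
  shows bounded_linear_al_functional: "bounded_linear (al_functional :: 'a::al_space \<Rightarrow> real)"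
    and al_functional_eq_norm: "0 \<le> (u::'a) \<Longrightarrow> al_functional u = norm u"
  using theI'[OF ex1_al_functional, folded al_functional_def] by blast+

section \<open>Linear operators with a domain\<close>

text \<open>An operator is given by its domain \<open>D\<close> and a total function whose values outside
  \<open>D\<close> are irrelevant.\<close>

definition linear_operator :: "'a::real_vector set \<Rightarrow> ('a \<Rightarrow> 'a) \<Rightarrow> bool" where
  "linear_operator D A \<longleftrightarrow> subspace D \<and>
     (\<forall>u\<in>D. \<forall>v\<in>D. A (u + v) = A u + A v) \<and> (\<forall>c. \<forall>u\<in>D. A (c *\<^sub>R u) = c *\<^sub>R A u)"

definition bounded_operator :: "'a::real_normed_vector set \<Rightarrow> ('a \<Rightarrow> 'a) \<Rightarrow> bool" where
  "bounded_operator X T \<longleftrightarrow> linear_operator X T \<and> (\<exists>K. \<forall>u\<in>X. norm (T u) \<le> K * norm u)"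

definition positive_operator :: "'a::ordered_real_vector set \<Rightarrow> ('a \<Rightarrow> 'a) \<Rightarrow> bool" where
  "positive_operator D A \<longleftrightarrow> (\<forall>u\<in>D. 0 \<le> u \<longrightarrow> 0 \<le> A u)"

definition resolvent :: "'a::real_vector set \<Rightarrow> ('a \<Rightarrow> 'a) \<Rightarrow> real \<Rightarrow> 'a \<Rightarrow> 'a" where
  "resolvent D A l = inv_into D (\<lambda>u. l *\<^sub>R u - A u)"

text \<open>The underlying space \<open>X\<close> is a parameter: the operator \<open>A\<close> below acts in the whole space,
  the generator in the closed subspace on which the semigroup acts.\<close>

definition resolvent_set :: "'a::real_normed_vector set \<Rightarrow> 'a set \<Rightarrow> ('a \<Rightarrow> 'a) \<Rightarrow> real set" where
  "resolvent_set X D A =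
     {l. bij_betw (\<lambda>u. l *\<^sub>R u - A u) D X \<and> bounded_operator X (resolvent D A l)}"

definition resolvent_positive :: "'a::banach_lattice set \<Rightarrow> ('a \<Rightarrow> 'a) \<Rightarrow> bool" where
  "resolvent_positive D A \<longleftrightarrow> (\<exists>w. {w<..} \<subseteq> resolvent_set UNIV D A \<and>
     (\<forall>l>w. positive_operator UNIV (resolvent D A l)))"

definition part_domain :: "'a set \<Rightarrow> 'a set \<Rightarrow> ('a \<Rightarrow> 'a) \<Rightarrow> 'a set" where
  "part_domain X D A = {u \<in> D. A u \<in> X}"

section \<open>Semigroups on a closed subspace\<close>

definition c0_semigroup :: "'a::real_normed_vector set \<Rightarrow> (real \<Rightarrow> 'a \<Rightarrow> 'a) \<Rightarrow> bool" where
  "c0_semigroup X S \<longleftrightarrow> subspace X \<and> closed X \<and>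
     (\<forall>t\<ge>0. S t ` X \<subseteq> X \<and> bounded_operator X (S t)) \<and>
     (\<forall>u\<in>X. S 0 u = u) \<and>
     (\<forall>s\<ge>0. \<forall>t\<ge>0. \<forall>u\<in>X. S (s + t) u = S s (S t u)) \<and>
     (\<forall>u\<in>X. ((\<lambda>t. S t u) \<longlongrightarrow> u) (at_right 0))"

definition substochastic_semigroup :: "'a::banach_lattice set \<Rightarrow> (real \<Rightarrow> 'a \<Rightarrow> 'a) \<Rightarrow> bool" where
  "substochastic_semigroup X S \<longleftrightarrow> c0_semigroup X S \<and>
     (\<forall>t\<ge>0. positive_operator X (S t) \<and> (\<forall>u\<in>X. 0 \<le> u \<longrightarrow> norm (S t u) \<le> norm u))"

definition generator_domain :: "'a::real_normed_vector set \<Rightarrow> (real \<Rightarrow> 'a \<Rightarrow> 'a) \<Rightarrow> 'a set" where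
  "generator_domain X S =
     {u \<in> X. \<exists>v\<in>X. ((\<lambda>h. (S h u - u) /\<^sub>R h) \<longlongrightarrow> v) (at_right 0)}"

definition generator :: "(real \<Rightarrow> 'a::real_normed_vector \<Rightarrow> 'a) \<Rightarrow> 'a \<Rightarrow> 'a" where
  "generator S u = Lim (at_right 0) (\<lambda>h. (S h u - u) /\<^sub>R h)"

end

(* The Neumann terms K n l = R(l,A) (B R(l,A))^n are positive and, since alpha (A u + B u) <= 0,
   the sums of |K n l u| telescope to at most |u| / l.  Hence S l = sum_n K n l converges
   absolutely, l S(l) is a contraction, and comparing coefficients in the resolvent equation of
   A + r B shows that S is a pseudo-resolvent, with S l (l u - A u - B u) = u on D.  The latter
   yields l S(l) u -> u on the closure of D, so the Hille-Yosida construction (Yosida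
   approximation) applies on that subspace even though A + B need not be closed. *)

theory Submission
  imports Defs
begin

section \<open>Exponentials of contractions\<close>

text \<open>For \<open>0 < l\<close> the operator \<open>B R(l, A)\<close> is a contraction whose
  norm may equal 1, so convergence of the Neumann series is only obtained pointwise, and its sum
  \<open>S l\<close> need not map into \<open>D\<close>. Hence \<open>S l\<close> inverts
  \<open>l - A - B\<close> from the left on \<open>D\<close>, but in general it is the resolvent of
  a larger operator that is not known beforehand. The semigroup is therefore built from the
  pseudo-resolvent alone, and its generator is read off afterwards on the range; injectivity on the
  closure of \<open>D\<close> is a by-product of that computation. Exponentials are written with
  Poisson weights because these are nonnegative and sum to 1: such an average of powers of a
  contraction is a contraction and preserves every closed convex cone that the contraction
  preserves. One lemma thus serves both positivity and invariance of the closure of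
  \<open>D\<close>.\<close>

lemma exp_series_has_vector_derivative:
  fixes x :: "nat \<Rightarrow> 'b::banach"
  assumes x: "\<And>n. norm (x n) \<le> 1"
  shows "((\<lambda>s. \<Sum>n. (s ^ n / fact n) *\<^sub>R x n) has_vector_derivative
    (\<Sum>n. (s ^ n / fact n) *\<^sub>R x (Suc n))) (at s)"
proof -
  \<comment> \<open>Any radius above |s| works: \<open>s\<close> is then interior to
    \<open>S\<close>, and \<open>K ^ n / fact n\<close> dominates the terms uniformly on
    \<open>S\<close>.\<close>
  define K where "K = \<bar>s\<bar> + 1"
  define S where "S = {-K<..<K}"
  define G where "G = (\<lambda>s. \<Sum>n. (s ^ n / fact n) *\<^sub>R x (Suc n))"
  define f' where "f' = (\<lambda>n s h. h *\<^sub>R ((real n * s ^ (n - 1) / fact n) *\<^sub>R x n))"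
  have K: "K > 0" "s \<in> S" "open S" "convex S" by (auto simp: K_def S_def abs_if)
  have smK: "summable (\<lambda>n. K ^ n / fact n)"
    using summable_exp[of K] by (simp add: field_simps)
  have dom: "norm ((r ^ n / fact n) *\<^sub>R y) \<le> K ^ n / fact n" if "r \<in> S" "norm y \<le> 1" for r n and y :: 'b
  proof -
    have "\<bar>r\<bar> \<le> K" using that by (auto simp: S_def)
    then have "\<bar>r\<bar> ^ n \<le> K ^ n" by (intro power_mono) auto
    then have "\<bar>r\<bar> ^ n / fact n * norm y \<le> K ^ n / fact n * 1"
      using that K by (intro mult_mono divide_right_mono) auto
    then show ?thesis by (simp add: power_abs)
  qed
  have ul: "uniform_limit S (\<lambda>n r. \<Sum>i<n. (r ^ i / fact i) *\<^sub>R x (Suc i)) G sequentially"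
    unfolding G_def by (rule Weierstrass_m_test[OF _ smK]) (use dom x in auto)
  \<comment> \<open>The term \<open>i = 0\<close> contributes nothing because of the factor
    \<open>real n\<close> in \<open>f'\<close>, so \<open>Suc n\<close> derivatives add up to
    \<open>n\<close> terms of the shifted series.\<close>
  have shift: "(\<Sum>i<Suc n. f' i r h) = h *\<^sub>R (\<Sum>i<n. (r ^ i / fact i) *\<^sub>R x (Suc i))" for n r h
    by (subst sum.lessThan_Suc_shift)
      (simp add: f'_def scaleR_sum_right field_simps flip: of_nat_Suc)
  have "\<exists>g. \<forall>r\<in>S. (\<lambda>n. (r ^ n / fact n) *\<^sub>R x n) sums (g r) \<and>
      (g has_derivative (\<lambda>h. h *\<^sub>R G r)) (at r within S)"
  proof (rule has_derivative_series[where f' = f'])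
    show "convex S" "s \<in> S" by fact+
    show "(\<lambda>n. (s ^ n / fact n) *\<^sub>R x n) sums (\<Sum>n. (s ^ n / fact n) *\<^sub>R x n)"
      by (rule summable_sums, rule summable_comparison_test[OF _ smK])
        (use dom K x in blast)
    show "((\<lambda>r. (r ^ n / fact n) *\<^sub>R x n) has_derivative f' n r) (at r within S)" for n r
      unfolding f'_def by (auto intro!: derivative_eq_intros simp: field_simps)
    show "\<forall>\<^sub>F n in sequentially. \<forall>r\<in>S. \<forall>h. norm (sum (\<lambda>i. f' i r h) {..<n} - h *\<^sub>R G r) \<le> e * norm h"
      if "e > 0" for e
    proof -
      have "\<forall>\<^sub>F n in sequentially. \<forall>r\<in>S. norm ((\<Sum>i<n. (r ^ i / fact i) *\<^sub>R x (Suc i)) - G r) < e"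
        using uniform_limitD[OF ul that] by (simp add: dist_norm)
      then have "\<forall>\<^sub>F n in sequentially. \<forall>r\<in>S. \<forall>h. norm (sum (\<lambda>i. f' i r h) {..<Suc n} - h *\<^sub>R G r) \<le> e * norm h"
      proof eventually_elim
        case (elim n)
        show ?case
        proof (intro ballI allI)
          fix r h assume "r \<in> S"
          then have "norm ((\<Sum>i<n. (r ^ i / fact i) *\<^sub>R x (Suc i)) - G r) \<le> e" using elim by force
          then show "norm (sum (\<lambda>i. f' i r h) {..<Suc n} - h *\<^sub>R G r) \<le> e * norm h"
            unfolding shift scaleR_right_diff_distrib[symmetric] norm_scaleR
            by (simp add: mult.commute[of e] mult_left_mono)
        qed
      qed
      then show ?thesis by (subst (asm) eventually_sequentially_Suc)
    qed
  qed
  then obtain g where g: "\<And>r. r \<in> S \<Longrightarrow> (\<lambda>n. (r ^ n / fact n) *\<^sub>R x n) sums (g r)"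
    "\<And>r. r \<in> S \<Longrightarrow> (g has_derivative (\<lambda>h. h *\<^sub>R G r)) (at r within S)" by blast
  have "(g has_vector_derivative G s) (at s)"
    using g(2)[OF K(2)] at_within_open[OF K(2,3)] by (simp add: has_vector_derivative_def)
  then have "((\<lambda>s. \<Sum>n. (s ^ n / fact n) *\<^sub>R x n) has_vector_derivative G s) (at s)"
    by (rule has_vector_derivative_transform_within_open[OF _ K(3,2)])
      (use g(1) in \<open>simp add: sums_iff\<close>)
  then show ?thesis by (simp add: G_def)
qed

definition poisson_power :: "('a::real_normed_vector \<Rightarrow>\<^sub>L 'a) \<Rightarrow> nat \<Rightarrow> 'a \<Rightarrow>\<^sub>L 'a" where
  "poisson_power Q n = ((\<lambda>V. Q o\<^sub>L V) ^^ n) id_blinfun"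

text \<open>The law of a Poisson number of steps of \<open>Q\<close>, so that \<open>poisson Q s = exp (s (Q - I))\<close>.\<close>

definition poisson :: "('a::banach \<Rightarrow>\<^sub>L 'a) \<Rightarrow> real \<Rightarrow> 'a \<Rightarrow>\<^sub>L 'a" where
  "poisson Q s = exp (- s) *\<^sub>R (\<Sum>n. (s ^ n / fact n) *\<^sub>R poisson_power Q n)"

lemma poisson_power_0 [simp]: "poisson_power Q 0 = id_blinfun"
  and poisson_power_Suc [simp]: "poisson_power Q (Suc n) = Q o\<^sub>L poisson_power Q n"
  by (simp_all add: poisson_power_def)

lemma norm_poisson_power:
  assumes "norm Q \<le> 1"
  shows "norm (poisson_power Q n) \<le> 1"
proof (induction n)
  case 0
  show ?case by (simp add: norm_blinfun_id_le)
next
  case (Suc n)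
  have "norm (Q o\<^sub>L poisson_power Q n) \<le> norm Q * norm (poisson_power Q n)"
    by (rule norm_blinfun_compose)
  also have "\<dots> \<le> 1" using mult_mono[OF assms Suc] by simp
  finally show ?case by simp
qed

context
  fixes Q :: "'a::banach \<Rightarrow>\<^sub>L 'a"
  assumes Q: "norm Q \<le> 1"
begin

lemma summable_norm_poisson: "summable (\<lambda>n. norm ((s ^ n / fact n) *\<^sub>R poisson_power Q n))"
proof (rule summable_comparison_test)
  show "summable (\<lambda>n. \<bar>s\<bar> ^ n / fact n)"
    using summable_exp[of "\<bar>s\<bar>"] by (simp add: field_simps)
  show "\<exists>N. \<forall>n\<ge>N. norm (norm ((s ^ n / fact n) *\<^sub>R poisson_power Q n)) \<le> \<bar>s\<bar> ^ n / fact n"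
    using norm_poisson_power[OF Q] by (auto simp: power_abs divide_le_cancel mult_left_le)
qed

lemma summable_poisson: "summable (\<lambda>n. (s ^ n / fact n) *\<^sub>R poisson_power Q n)"
  using summable_norm_poisson by (rule summable_norm_cancel)

lemma poisson_apply: "poisson Q s u = exp (- s) *\<^sub>R (\<Sum>n. (s ^ n / fact n) *\<^sub>R poisson_power Q n u)"
proof -
  have "blinfun_apply (\<Sum>n. (s ^ n / fact n) *\<^sub>R poisson_power Q n) u
      = (\<Sum>n. blinfun_apply ((s ^ n / fact n) *\<^sub>R poisson_power Q n) u)"
    using bounded_linear.suminf[OF blinfun.bounded_linear_left summable_poisson] by metis
  then show ?thesis by (simp add: poisson_def blinfun.scaleR_left)
qed

lemma summable_poisson_apply: "summable (\<lambda>n. (s ^ n / fact n) *\<^sub>R poisson_power Q n u)"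
  using bounded_linear.summable[OF blinfun.bounded_linear_left[of u] summable_poisson]
  by (simp add: blinfun.scaleR_left)

lemma poisson_has_vector_derivative:
  "(poisson Q has_vector_derivative (Q - id_blinfun) o\<^sub>L poisson Q s) (at s)"
proof -
  let ?f = "\<lambda>s. \<Sum>n. (s ^ n / fact n) *\<^sub>R poisson_power Q n"
  have "(?f has_vector_derivative (\<Sum>n. (s ^ n / fact n) *\<^sub>R poisson_power Q (Suc n))) (at s)"
    by (rule exp_series_has_vector_derivative) (rule norm_poisson_power[OF Q])
  also have "(\<Sum>n. (s ^ n / fact n) *\<^sub>R poisson_power Q (Suc n)) = Q o\<^sub>L ?f s"
    using bounded_linear.suminf[OF bounded_bilinear.bounded_linear_right[OF bounded_bilinear_blinfun_compose] summable_poisson, of Q]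
    by (simp add: bounded_bilinear.scaleR_right[OF bounded_bilinear_blinfun_compose])
  finally have "((\<lambda>s. exp (- s) *\<^sub>R ?f s) has_vector_derivative
      exp (- s) *\<^sub>R (Q o\<^sub>L ?f s) + (- exp (- s)) *\<^sub>R ?f s) (at s)"
    by (intro has_vector_derivative_scaleR) (auto intro!: derivative_eq_intros)
  then show ?thesis
    unfolding poisson_def[abs_def]
    by (rule has_vector_derivative_eq_rhs)
      (auto intro!: blinfun_eqI simp: blinfun.bilinear_simps algebra_simps)
qed

text \<open>For \<open>0 \<le> s\<close> the weights are nonnegative and add up to
  \<open>exp s\<close>, which the prefactor cancels.\<close>

lemma norm_poisson_le_1:
  assumes "0 \<le> s"
  shows "norm (poisson Q s) \<le> 1"
proof -
  have sm: "summable (\<lambda>n. s ^ n / fact n)"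
    using summable_exp[of s] by (simp add: field_simps)
  have "norm (\<Sum>n. (s ^ n / fact n) *\<^sub>R poisson_power Q n)
      \<le> (\<Sum>n. norm ((s ^ n / fact n) *\<^sub>R poisson_power Q n))"
    by (rule summable_norm[OF summable_norm_poisson])
  also have "\<dots> \<le> (\<Sum>n. s ^ n / fact n)"
    using norm_poisson_power[OF Q] assms
    by (intro suminf_le summable_norm_poisson sm) (auto simp: mult_left_le divide_right_mono)
  also have "\<dots> = exp s" by (simp add: exp_def field_simps)
  finally have "exp (- s) * norm (\<Sum>n. (s ^ n / fact n) *\<^sub>R poisson_power Q n) \<le> exp (- s) * exp s"
    by (rule mult_left_mono) simp
  then show ?thesis by (simp add: poisson_def exp_minus)
qed

text \<open>Stated for an arbitrary closed convex cone so that it applies both to the closed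
  subspace \<open>X\<close> and to the positive cone.\<close>

lemma poisson_in_cone:
  assumes C: "closed C" "0 \<in> C" "\<And>u v. u \<in> C \<Longrightarrow> v \<in> C \<Longrightarrow> u + v \<in> C"
      "\<And>c u. 0 \<le> c \<Longrightarrow> u \<in> C \<Longrightarrow> c *\<^sub>R u \<in> C"
    and QC: "\<And>u. u \<in> C \<Longrightarrow> Q u \<in> C" and "u \<in> C" "0 \<le> s"
  shows "poisson Q s u \<in> C"
proof -
  have power: "poisson_power Q n u \<in> C" for n
    by (induction n) (simp_all add: QC \<open>u \<in> C\<close>)
  have "(\<Sum>n<N. (s ^ n / fact n) *\<^sub>R poisson_power Q n u) \<in> C" for N
    by (induction N) (simp_all add: C power \<open>0 \<le> s\<close>)
  then have "(\<Sum>n. (s ^ n / fact n) *\<^sub>R poisson_power Q n u) \<in> C"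
    using closed_sequentially[OF C(1) _ summable_LIMSEQ[OF summable_poisson_apply]] by blast
  then show ?thesis by (simp add: poisson_apply C)
qed

lemma poisson_commute:
  assumes "V o\<^sub>L Q = Q o\<^sub>L V"
  shows "V o\<^sub>L poisson Q s = poisson Q s o\<^sub>L V"
proof -
  have "V o\<^sub>L poisson_power Q n = poisson_power Q n o\<^sub>L V" for n
  proof (induction n)
    case 0
    show ?case by (auto intro: blinfun_eqI)
  next
    case (Suc n)
    have "V o\<^sub>L (Q o\<^sub>L poisson_power Q n) = (V o\<^sub>L Q) o\<^sub>L poisson_power Q n"
      by (auto intro: blinfun_eqI)
    also have "\<dots> = Q o\<^sub>L (V o\<^sub>L poisson_power Q n)"
      unfolding assms by (auto intro: blinfun_eqI)
    also have "\<dots> = (Q o\<^sub>L poisson_power Q n) o\<^sub>L V"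
      unfolding Suc by (auto intro: blinfun_eqI)
    finally show ?case by simp
  qed
  then show ?thesis
    using bounded_linear.suminf[OF bounded_bilinear.bounded_linear_right[OF bounded_bilinear_blinfun_compose] summable_poisson, of V s]
      bounded_linear.suminf[OF bounded_bilinear.bounded_linear_left[OF bounded_bilinear_blinfun_compose] summable_poisson, of s V]
    by (simp add: poisson_def bounded_bilinear.scaleR_right[OF bounded_bilinear_blinfun_compose] bounded_bilinear.scaleR_left[OF bounded_bilinear_blinfun_compose])
qed

end

lemma poisson_0 [simp]: "poisson Q 0 = id_blinfun"
proof -
  have "(\<Sum>n. ((0::real) ^ n / fact n) *\<^sub>R poisson_power Q n) = (\<Sum>n\<in>{0}. (0 ^ n / fact n) *\<^sub>R poisson_power Q n)"
    by (rule suminf_finite) (auto simp: power_0_left)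
  then show ?thesis by (simp add: poisson_def)
qed

section \<open>Semigroups from contractive pseudo-resolvents\<close>

lemma norm_blinfun_apply_le: "norm V \<le> 1 \<Longrightarrow> norm (blinfun_apply V u) \<le> norm u"
  using norm_blinfun[of V u] mult_right_mono[of "norm V" 1 "norm u"] by simp

lemma norm_add_diff_triangle:
  fixes a b c :: "'a::real_normed_vector"
  shows "norm (a + b - c) \<le> norm a + norm b + norm c"
  using norm_triangle_ineq4[of "a + b" c] norm_triangle_ineq[of a b] by linarith

lemma small_multiple:
  fixes c e :: real
  assumes "0 < e" "0 \<le> c"
  shows "\<forall>\<^sub>F h in at_right 0. 0 < h \<and> h * c < e"
\<comment> \<open>Dividing by \<open>c + 1\<close> instead of \<open>c\<close> covers the case
  \<open>c = 0\<close>.\<close>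
proof (rule eventually_at_rightI[of 0 "e / (c + 1)"])
  fix h assume h: "h \<in> {0<..<e / (c + 1)}"
  then have "h * (c + 1) < e" using assms by (simp add: field_simps)
  then show "0 < h \<and> h * c < e" using h by (simp add: algebra_simps)
qed (use assms in simp)

text \<open>\<open>Y n t\<close> below is the Yosida approximation \<open>exp (t (N\<^sup>2 T N - N))\<close> with
  \<open>N = n + 1\<close>, the shift avoiding the parameter \<open>0\<close>.\<close>

locale contraction_resolvent =
  fixes T :: "real \<Rightarrow> 'a::banach \<Rightarrow>\<^sub>L 'a" and X :: "'a set"
  assumes contraction: "0 < l \<Longrightarrow> norm (l *\<^sub>R T l) \<le> 1"
    and resolvent_eq: "0 < l \<Longrightarrow> 0 < m \<Longrightarrow> T l - T m = (m - l) *\<^sub>R (T l o\<^sub>L T m)"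
    and subspace: "subspace X" and closed: "closed X"
    and invariant: "0 < l \<Longrightarrow> u \<in> X \<Longrightarrow> T l u \<in> X"
    and approx: "u \<in> X \<Longrightarrow> (\<lambda>n. real (Suc n) *\<^sub>R T (Suc n) u) \<longlonglongrightarrow> u"
begin

section \<open>Bounded approximations of the generator and their exponentials\<close>

abbreviation J :: "nat \<Rightarrow> 'a \<Rightarrow>\<^sub>L 'a" where
  "J n \<equiv> real (Suc n) *\<^sub>R T (Suc n)"

definition G :: "nat \<Rightarrow> 'a \<Rightarrow>\<^sub>L 'a" where
  "G n = real (Suc n) *\<^sub>R (J n - id_blinfun)"

definition Y :: "nat \<Rightarrow> real \<Rightarrow> 'a \<Rightarrow>\<^sub>L 'a" where
  "Y n t = poisson (J n) (real (Suc n) * t)"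

lemma norm_J: "norm (J n) \<le> 1"
  using contraction[of "real (Suc n)"] by simp

lemma norm_J_apply: "norm (J n u) \<le> norm u"
  by (rule norm_blinfun_apply_le[OF norm_J])

text \<open>Exchanging \<open>l\<close> and \<open>m\<close> in the resolvent equation changes the
  sign of the left side and of the scalar factor on the right.\<close>

lemma T_commute: "0 < l \<Longrightarrow> 0 < m \<Longrightarrow> T l o\<^sub>L T m = T m o\<^sub>L T l"
proof (cases "l = m")
  case False
  assume "0 < l" "0 < m"
  then have "(m - l) *\<^sub>R (T l o\<^sub>L T m) = (m - l) *\<^sub>R (T m o\<^sub>L T l)"
    using resolvent_eq[of l m] resolvent_eq[of m l] by (metis minus_diff_eq scaleR_minus_left)
  then show ?thesis using False by simp
qed simp

lemma J_commute: "J m o\<^sub>L J n = J n o\<^sub>L J m"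
  using T_commute[of "Suc m" "Suc n"]
  by (simp add: bounded_bilinear.scaleR_left[OF bounded_bilinear_blinfun_compose]
      bounded_bilinear.scaleR_right[OF bounded_bilinear_blinfun_compose])

lemma Y_J_commute: "J m o\<^sub>L Y n t = Y n t o\<^sub>L J m"
  unfolding Y_def by (rule poisson_commute[OF norm_J J_commute])

lemma Y_G_commute: "G m (Y n t u) = Y n t (G m u)"
  using arg_cong[OF Y_J_commute[of m n t], of "\<lambda>V. blinfun_apply V u"]
  by (simp add: G_def blinfun.bilinear_simps)

lemma Y_0 [simp]: "Y n 0 = id_blinfun"
  by (simp add: Y_def)

lemma norm_Y: "0 \<le> t \<Longrightarrow> norm (Y n t) \<le> 1"
  unfolding Y_def by (intro norm_poisson_le_1[OF norm_J]) simp

lemma norm_Y_apply: "0 \<le> t \<Longrightarrow> norm (Y n t u) \<le> norm u"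
  by (rule norm_blinfun_apply_le[OF norm_Y])

lemma Y_has_vector_derivative: "(Y n has_vector_derivative G n o\<^sub>L Y n t) (at t within S)"
proof -
  have "((poisson (J n) \<circ> (\<lambda>t. real (Suc n) * t)) has_vector_derivative
      real (Suc n) *\<^sub>R ((J n - id_blinfun) o\<^sub>L poisson (J n) (real (Suc n) * t))) (at t)"
    by (rule vector_diff_chain_at[OF _ poisson_has_vector_derivative[OF norm_J]])
      (auto intro!: derivative_eq_intros)
  then have "(Y n has_vector_derivative G n o\<^sub>L Y n t) (at t)"
    by (simp add: Y_def[abs_def] G_def o_def bounded_bilinear.scaleR_left[OF bounded_bilinear_blinfun_compose])
  then show ?thesis by (rule has_vector_derivative_at_within)
qed

lemma Y_apply_has_vector_derivative:
  "((\<lambda>t. Y n t u) has_vector_derivative Y n t (G n u)) (at t within S)"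
  using bounded_linear.has_vector_derivative[OF blinfun.bounded_linear_left[of u] Y_has_vector_derivative]
  by (simp add: Y_G_commute)

text \<open>Duhamel interpolation: the curve leads from \<open>Y n t u\<close> at
  \<open>s = 0\<close> to \<open>Y m t u\<close> at \<open>s = t\<close>. Commutation moves both
  generators onto \<open>u\<close>, so that only their difference remains.\<close>

lemma Y_product_has_vector_derivative:
  "((\<lambda>s. Y n (t - s) (Y m s u)) has_vector_derivative Y n (t - s) (Y m s (G m u - G n u)))
    (at s within S)"
proof -
  have "((Y n \<circ> (\<lambda>s. t - s)) has_vector_derivative (- 1) *\<^sub>R (G n o\<^sub>L Y n (t - s))) (at s within S)"
    by (rule vector_diff_chain_within)
      (auto intro!: derivative_eq_intros Y_has_vector_derivative)
  then have "((\<lambda>s. Y n (t - s)) has_vector_derivative (- 1) *\<^sub>R (G n o\<^sub>L Y n (t - s))) (at s within S)"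
    by (simp add: o_def)
  from bounded_bilinear.has_vector_derivative[OF bounded_bilinear_blinfun_apply this
      Y_apply_has_vector_derivative[of m u s S]]
  show ?thesis
    by (rule has_vector_derivative_eq_rhs) (simp add: blinfun.bilinear_simps Y_G_commute)
qed

lemma Y_diff_le:
  assumes "0 \<le> t"
  shows "norm (Y m t u - Y n t u) \<le> t * norm (G m u - G n u)"
proof -
  have "norm (Y n (t - t) (Y m t u) - Y n (t - 0) (Y m 0 u)) \<le> norm (G m u - G n u) * norm (t - 0)"
  proof (rule differentiable_bound[of "{0..t}"])
    fix s assume s: "s \<in> {0..t}"
    show "((\<lambda>s. Y n (t - s) (Y m s u)) has_derivative (\<lambda>h. h *\<^sub>R Y n (t - s) (Y m s (G m u - G n u))))
      (at s within {0..t})"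
      using Y_product_has_vector_derivative[of n t m u s] by (simp add: has_vector_derivative_def)
    have "norm (Y n (t - s) (Y m s (G m u - G n u))) \<le> norm (G m u - G n u)"
      using s norm_Y_apply[of "t - s" n "Y m s (G m u - G n u)"] norm_Y_apply[of s m "G m u - G n u"] by simp
    then show "onorm (\<lambda>h. h *\<^sub>R Y n (t - s) (Y m s (G m u - G n u))) \<le> norm (G m u - G n u)"
      by (intro onorm_bound) (auto simp: mult.commute mult_left_mono)
  qed (use assms in auto)
  then show ?thesis using assms by (simp add: mult.commute)
qed

text \<open>For \<open>m = n\<close> the interpolating curve with total time \<open>s + t\<close>
  has derivative 0; its values at \<open>r = 0\<close> and \<open>r = t\<close> are the two
  sides.\<close>

lemma Y_add: "0 \<le> s \<Longrightarrow> 0 \<le> t \<Longrightarrow> Y n (s + t) u = Y n s (Y n t u)"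
proof -
  assume "0 \<le> s" "0 \<le> t"
  have "norm (Y n (s + t - t) (Y n t u) - Y n (s + t - 0) (Y n 0 u)) \<le> 0 * norm (t - 0)"
  proof (rule differentiable_bound[of "{0..t}"])
    fix r
    show "((\<lambda>r. Y n (s + t - r) (Y n r u)) has_derivative (\<lambda>h. h *\<^sub>R 0)) (at r within {0..t})"
      using Y_product_has_vector_derivative[of n "s + t" n u r]
      by (simp add: has_vector_derivative_def)
  qed (use \<open>0 \<le> t\<close> in \<open>auto simp: onorm_zero\<close>)
  then show ?thesis by simp
qed

lemma Y_diff_id_le: "0 \<le> t \<Longrightarrow> norm (Y n t u - u) \<le> t * norm (G n u)"
proof -
  assume t: "0 \<le> t"
  have "norm (Y n t u - Y n 0 u) \<le> norm (G n u) * norm (t - 0)"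
  proof (rule differentiable_bound[of "{0..t}"])
    fix s assume s: "s \<in> {0..t}"
    show "((\<lambda>s. Y n s u) has_derivative (\<lambda>h. h *\<^sub>R Y n s (G n u))) (at s within {0..t})"
      using Y_apply_has_vector_derivative[of n u s] by (simp add: has_vector_derivative_def)
    show "onorm (\<lambda>h. h *\<^sub>R Y n s (G n u)) \<le> norm (G n u)"
      using s norm_Y_apply[of s n "G n u"]
      by (intro onorm_bound) (auto simp: mult.commute mult_left_mono)
  qed (use t in auto)
  then show ?thesis using t by (simp add: mult.commute)
qed

text \<open>Mean value estimate for \<open>Y n s u - s *\<^sub>R w\<close>, whose derivative is
  \<open>Y n s w - w\<close>. With \<open>c\<close> controlled uniformly in \<open>n\<close>, the
  first-order remainder survives the passage to the limit semigroup.\<close>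

lemma Y_quotient_le:
  assumes h: "0 \<le> h" and B: "\<And>s. s \<in> {0..h} \<Longrightarrow> norm (Y n s w - w) \<le> c" and w: "w = G n u"
  shows "norm (Y n h u - u - h *\<^sub>R w) \<le> h * c"
proof -
  have "norm ((Y n h u - h *\<^sub>R w) - (Y n 0 u - 0 *\<^sub>R w)) \<le> c * norm (h - 0)"
  proof (rule differentiable_bound[of "{0..h}"])
    fix s assume s: "s \<in> {0..h}"
    have "((\<lambda>s. Y n s u - s *\<^sub>R w) has_vector_derivative (Y n s w - w)) (at s within {0..h})"
      unfolding w by (auto intro!: derivative_eq_intros Y_apply_has_vector_derivative)
    then show "((\<lambda>s. Y n s u - s *\<^sub>R w) has_derivative (\<lambda>r. r *\<^sub>R (Y n s w - w))) (at s within {0..h})"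
      by (simp add: has_vector_derivative_def)
    show "onorm (\<lambda>r. r *\<^sub>R (Y n s w - w)) \<le> c"
      using B[OF s] order_trans[OF norm_ge_zero B[OF s]]
        by (intro onorm_bound) (auto simp: mult.commute[of c] mult_left_mono)
  qed (use h in auto)
  then show ?thesis using h by (simp add: mult.commute algebra_simps)
qed

text \<open>On the range of \<open>T l\<close> the resolvent equation absorbs the growing factor
  \<open>Suc n\<close> of \<open>G n\<close>: what is left is a contraction applied to a vector
  independent of \<open>n\<close>. This gives boundedness and, on \<open>X\<close>,
  convergence.\<close>

lemma G_T: "0 < l \<Longrightarrow> G n (T l v) = J n (l *\<^sub>R T l v - v)"
proof -
  assume "0 < l"
  then have "T (Suc n) v - T l v = (l - Suc n) *\<^sub>R T (Suc n) (T l v)"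
    using arg_cong[OF resolvent_eq[of "Suc n" l], of "\<lambda>V. blinfun_apply V v"]
    by (simp add: blinfun.bilinear_simps)
  then have *: "T l v = T (Suc n) v - (l - Suc n) *\<^sub>R T (Suc n) (T l v)"
    by (simp add: algebra_simps)
  have "G n (T l v) = real (Suc n) *\<^sub>R (real (Suc n) *\<^sub>R T (Suc n) (T l v) - T l v)"
    by (simp add: G_def blinfun.bilinear_simps del: of_nat_Suc)
  also have "\<dots> = real (Suc n) *\<^sub>R (l *\<^sub>R T (Suc n) (T l v) - T (Suc n) v)"
    by (subst (2) *) (simp add: scaleR_left_diff_distrib del: of_nat_Suc)
  also have "\<dots> = J n (l *\<^sub>R T l v - v)"
    by (simp add: blinfun.bilinear_simps scaleR_right_diff_distrib mult.commute del: of_nat_Suc)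
  finally show ?thesis .
qed

lemma G_T_tendsto: "0 < l \<Longrightarrow> v \<in> X \<Longrightarrow> (\<lambda>n. G n (T l v)) \<longlonglongrightarrow> l *\<^sub>R T l v - v"
  using approx[of "l *\<^sub>R T l v - v"] subspace invariant[of l v]
  by (simp add: G_T subspace_diff subspace_scale blinfun.scaleR_left)

text \<open>The common range is the future domain of the generator. The resolvent equation exhibits
  \<open>T l v\<close> as \<open>T m (v + (m - l) *\<^sub>R T l v)\<close>.\<close>

lemma range_T_eq:
  assumes "0 < l" "0 < m"
  shows "T l ` X = T m ` X"
proof -
  have "T l ` X \<subseteq> T m ` X" if "0 < l" "0 < m" for l m
  proof
    fix u assume "u \<in> T l ` X"
    then obtain v where v: "v \<in> X" "u = T l v" by blast
    have "T m v - T l v = (l - m) *\<^sub>R T m (T l v)"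
      using arg_cong[OF resolvent_eq[of m l], of "\<lambda>V. blinfun_apply V v"] that
      by (simp add: blinfun.bilinear_simps)
    then have "u = T m (v + (m - l) *\<^sub>R T l v)"
      by (simp add: v blinfun.bilinear_simps algebra_simps)
    moreover have "v + (m - l) *\<^sub>R T l v \<in> X"
      using subspace v invariant[of l v] that by (simp add: subspace_add subspace_scale)
    ultimately show "u \<in> T m ` X" by blast
  qed
  with assms show ?thesis by blast
qed

lemma J_in_range: "u \<in> X \<Longrightarrow> J n u \<in> T 1 ` X"
proof -
  assume "u \<in> X"
  then have "J n u = T (Suc n) (real (Suc n) *\<^sub>R u)" "real (Suc n) *\<^sub>R u \<in> X"
    using subspace by (simp_all add: blinfun.bilinear_simps subspace_scale del: of_nat_Suc)
  then have "J n u \<in> T (Suc n) ` X" by blast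
  then show ?thesis using range_T_eq[of "Suc n" 1] by simp
qed

text \<open>The vectors \<open>J k w\<close> lie in the common range and converge to
  \<open>w\<close>; the parameter 1 is an arbitrary normalisation.\<close>

lemma range_T_dense:
  assumes "w \<in> X" "0 < e"
  obtains v where "v \<in> X" "norm (w - T 1 v) < e"
proof -
  obtain k where k: "norm (J k w - w) < e"
    using LIMSEQ_D[OF approx[OF assms(1)] assms(2)] by (auto simp: blinfun.scaleR_left)
  then show ?thesis
    using J_in_range[OF assms(1), of k] that by (auto simp: norm_minus_commute)
qed

section \<open>The limit semigroup\<close>

definition P :: "real \<Rightarrow> 'a \<Rightarrow> 'a" where
  "P t u = lim (\<lambda>n. Y n t u)"

text \<open>On the range of \<open>T 1\<close> the generators converge, so \<open>Y_diff_le\<close>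
  gives a Cauchy sequence; contractivity uniform in \<open>n\<close> carries this over to
  \<open>X\<close> by density. The two density errors cost \<open>e / 4\<close> each and the range
  part \<open>e / 2\<close>.\<close>

lemma Y_tendsto:
  assumes "0 \<le> t" "u \<in> X"
  shows "(\<lambda>n. Y n t u) \<longlonglongrightarrow> P t u"
proof -
  have "Cauchy (\<lambda>n. Y n t u)"
  proof (rule metric_CauchyI)
    fix e :: real assume "e > 0"
    then obtain v where v: "v \<in> X" "norm (u - T 1 v) < e / 4"
      using range_T_dense[OF assms(2), of "e / 4"] by auto
    have "Cauchy (\<lambda>n. G n (T 1 v))"
      by (rule LIMSEQ_imp_Cauchy[OF G_T_tendsto[OF zero_less_one v(1)]])
    \<comment> \<open>The denominator uses \<open>t + 1\<close> so that \<open>t = 0\<close> needs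
      no separate case.\<close>
    then obtain N where N: "\<And>m n. m \<ge> N \<Longrightarrow> n \<ge> N \<Longrightarrow> dist (G m (T 1 v)) (G n (T 1 v)) < e / (2 * (t + 1))"
      using metric_CauchyD[of _ "e / (2 * (t + 1))"] \<open>e > 0\<close> assms(1) by (metis add_nonneg_pos divide_pos_pos mult_pos_pos zero_less_numeral zero_less_one)
    have "dist (Y m t u) (Y n t u) < e" if "m \<ge> N" "n \<ge> N" for m n
    proof -
      let ?d = "u - T 1 v"
      have eq: "Y m t u - Y n t u = Y m t ?d - Y n t ?d + (Y m t (T 1 v) - Y n t (T 1 v))"
        by (simp add: blinfun.bilinear_simps)
      have "norm (Y m t ?d) \<le> norm ?d" "norm (Y n t ?d) \<le> norm ?d"
        using assms(1) by (simp_all add: norm_Y_apply)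
      moreover note v(2)
      moreover have "norm (Y m t (T 1 v) - Y n t (T 1 v)) \<le> e / 2"
      proof -
        have "norm (Y m t (T 1 v) - Y n t (T 1 v)) \<le> t * norm (G m (T 1 v) - G n (T 1 v))"
          by (rule Y_diff_le[OF assms(1)])
        also have "\<dots> \<le> t * (e / (2 * (t + 1)))"
          using N[OF that] assms(1) by (intro mult_left_mono) (auto simp: dist_norm)
        also have "\<dots> \<le> e / 2" using assms(1) \<open>e > 0\<close> by (simp add: field_simps)
        finally show ?thesis .
      qed
      ultimately show ?thesis
        using norm_triangle_ineq[of "Y m t ?d - Y n t ?d" "Y m t (T 1 v) - Y n t (T 1 v)"]
          norm_triangle_ineq4[of "Y m t ?d" "Y n t ?d"] unfolding dist_norm eq by linarith
    qed
    then show "\<exists>M. \<forall>m\<ge>M. \<forall>n\<ge>M. dist (Y m t u) (Y n t u) < e" by blast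
  qed
  then show ?thesis unfolding P_def by (simp add: Cauchy_convergent convergent_LIMSEQ_iff[symmetric])
qed

lemma P_in_cone:
  assumes C: "closed C" "0 \<in> C" "\<And>u v. u \<in> C \<Longrightarrow> v \<in> C \<Longrightarrow> u + v \<in> C"
      "\<And>c u. 0 \<le> c \<Longrightarrow> u \<in> C \<Longrightarrow> c *\<^sub>R u \<in> C"
    and T: "\<And>l u. 0 < l \<Longrightarrow> u \<in> C \<Longrightarrow> T l u \<in> C"
    and u: "u \<in> C" "u \<in> X" and t: "0 \<le> t"
  shows "P t u \<in> C"
proof -
  have "Y n t u \<in> C" for n
    unfolding Y_def
    by (rule poisson_in_cone[OF norm_J C _ u(1)]) (use C T t in \<open>auto simp: blinfun.scaleR_left\<close>)
  then show ?thesis by (rule closed_sequentially[OF C(1) _ Y_tendsto[OF t u(2)]])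
qed

lemma P_in_X: "0 \<le> t \<Longrightarrow> u \<in> X \<Longrightarrow> P t u \<in> X"
  by (rule P_in_cone)
    (use subspace closed invariant in \<open>auto simp: subspace_0 subspace_add subspace_scale\<close>)

lemma norm_P: "0 \<le> t \<Longrightarrow> u \<in> X \<Longrightarrow> norm (P t u) \<le> norm u"
  by (rule LIMSEQ_le_const2[OF tendsto_norm[OF Y_tendsto]]) (auto simp: norm_Y_apply)

lemma P_add_vector: "0 \<le> t \<Longrightarrow> u \<in> X \<Longrightarrow> v \<in> X \<Longrightarrow> P t (u + v) = P t u + P t v"
  using tendsto_add[OF Y_tendsto[of t u] Y_tendsto[of t v]] Y_tendsto[of t "u + v"] subspace
  by (auto simp: blinfun.bilinear_simps subspace_add intro: LIMSEQ_unique)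

lemma P_scaleR: "0 \<le> t \<Longrightarrow> u \<in> X \<Longrightarrow> P t (c *\<^sub>R u) = c *\<^sub>R P t u"
  using tendsto_scaleR[OF tendsto_const[of c] Y_tendsto[of t u]] Y_tendsto[of t "c *\<^sub>R u"] subspace
  by (auto simp: blinfun.bilinear_simps subspace_scale intro: LIMSEQ_unique)

lemma P_diff_vector: "0 \<le> t \<Longrightarrow> u \<in> X \<Longrightarrow> v \<in> X \<Longrightarrow> P t (u - v) = P t u - P t v"
  using P_add_vector[of t u "(- 1) *\<^sub>R v"] P_scaleR[of t v "- 1"] subspace
  by (simp add: subspace_neg)

lemma P_0: "P 0 u = u"
  by (simp add: P_def)

lemma P_semigroup:
  assumes "0 \<le> s" "0 \<le> t" "u \<in> X"
  shows "P (s + t) u = P s (P t u)"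
proof (rule LIMSEQ_unique)
  show "(\<lambda>n. Y n (s + t) u) \<longlonglongrightarrow> P (s + t) u"
    using assms by (intro Y_tendsto) auto
  \<comment> \<open>Operator and argument both vary with \<open>n\<close>; the uniform contraction
    bound allows the inner limit to be taken first.\<close>
  have "(\<lambda>n. Y n s (Y n t u - P t u)) \<longlonglongrightarrow> 0"
  proof (rule Lim_null_comparison)
    show "\<forall>\<^sub>F n in sequentially. norm (Y n s (Y n t u - P t u)) \<le> norm (Y n t u - P t u)"
      using assms by (simp add: norm_Y_apply)
    show "(\<lambda>n. norm (Y n t u - P t u)) \<longlonglongrightarrow> 0"
      using Y_tendsto[OF assms(2,3)] by (simp add: LIM_zero_iff tendsto_norm_zero_iff)
  qed
  from tendsto_add[OF this Y_tendsto[OF assms(1) P_in_X[OF assms(2,3)]]]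
  show "(\<lambda>n. Y n (s + t) u) \<longlonglongrightarrow> P s (P t u)"
    by (simp add: Y_add[OF assms(1,2)] blinfun.bilinear_simps)
qed

text \<open>A modulus of continuity at time 0 that is independent of \<open>n\<close> and valid for
  every \<open>w\<close> and \<open>v\<close>. It passes to \<open>P\<close>, and it also applies
  when \<open>w\<close> is \<open>G n (T l u)\<close>, which itself depends on
  \<open>n\<close>.\<close>

lemma Y_diff_id_le':
  assumes "0 \<le> t"
  shows "norm (Y n t w - w) \<le> 2 * norm (w - T 1 v) + t * norm (T 1 v - v)"
proof -
  have "Y n t w - w = Y n t (w - T 1 v) + (Y n t (T 1 v) - T 1 v) - (w - T 1 v)"
    by (simp add: blinfun.bilinear_simps)
  then have "norm (Y n t w - w)
      \<le> norm (Y n t (w - T 1 v)) + norm (Y n t (T 1 v) - T 1 v) + norm (w - T 1 v)"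
    by (simp only: norm_add_diff_triangle)
  moreover have "norm (Y n t (w - T 1 v)) \<le> norm (w - T 1 v)"
    using assms by (rule norm_Y_apply)
  moreover have "norm (Y n t (T 1 v) - T 1 v) \<le> t * norm (T 1 v - v)"
  proof -
    have "norm (Y n t (T 1 v) - T 1 v) \<le> t * norm (G n (T 1 v))"
      using assms by (rule Y_diff_id_le)
    also have "norm (G n (T 1 v)) \<le> norm (T 1 v - v)"
      using G_T[of 1 n v] norm_J_apply[of n "T 1 v - v"] by simp
    finally show ?thesis using assms by (simp add: mult_left_mono)
  qed
  ultimately show ?thesis by simp
qed

lemma P_diff_id_le:
  assumes "0 \<le> t" "w \<in> X"
  shows "norm (P t w - w) \<le> 2 * norm (w - T 1 v) + t * norm (T 1 v - v)"
  by (rule LIMSEQ_le_const2[OF tendsto_norm[OF tendsto_diff[OF Y_tendsto[OF assms] tendsto_const]]])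
    (use Y_diff_id_le'[OF assms(1)] in blast)

text \<open>The limit of \<open>Y_quotient_le\<close> with \<open>w = G n (T l u)\<close>. The
  vector \<open>v\<close> stays free, to be chosen later with \<open>T 1 v\<close> close to
  \<open>l *\<^sub>R T l u - u\<close>.\<close>

lemma P_quotient_le:
  assumes "0 \<le> h" "0 < l" "u \<in> X"
  shows "norm (P h (T l u) - T l u - h *\<^sub>R (l *\<^sub>R T l u - u))
    \<le> h * (2 * norm ((l *\<^sub>R T l u - u) - T 1 v) + h * norm (T 1 v - v))"
proof (rule LIMSEQ_le)
  show "(\<lambda>n. norm (Y n h (T l u) - T l u - h *\<^sub>R G n (T l u)))
      \<longlonglongrightarrow> norm (P h (T l u) - T l u - h *\<^sub>R (l *\<^sub>R T l u - u))"
    using assms by (intro tendsto_intros Y_tendsto invariant G_T_tendsto)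
  show "(\<lambda>n. h * (2 * norm (G n (T l u) - T 1 v) + h * norm (T 1 v - v)))
      \<longlonglongrightarrow> h * (2 * norm ((l *\<^sub>R T l u - u) - T 1 v) + h * norm (T 1 v - v))"
    using assms by (intro tendsto_intros G_T_tendsto)
  have "norm (Y n h (T l u) - T l u - h *\<^sub>R G n (T l u))
      \<le> h * (2 * norm (G n (T l u) - T 1 v) + h * norm (T 1 v - v))" for n
  proof (rule Y_quotient_le[OF assms(1) _ refl])
    fix s assume "s \<in> {0..h}"
    then show "norm (Y n s (G n (T l u)) - G n (T l u))
        \<le> 2 * norm (G n (T l u) - T 1 v) + h * norm (T 1 v - v)"
      using Y_diff_id_le'[of s n "G n (T l u)" v] mult_right_mono[of s h "norm (T 1 v - v)"] by simp
  qed
  then show "\<exists>N. \<forall>n\<ge>N. norm (Y n h (T l u) - T l u - h *\<^sub>R G n (T l u))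
      \<le> h * (2 * norm (G n (T l u) - T 1 v) + h * norm (T 1 v - v))"
    by blast
qed

lemma P_tendsto_id:
  assumes "u \<in> X"
  shows "((\<lambda>t. P t u) \<longlongrightarrow> u) (at_right 0)"
proof (rule tendstoI)
  fix e :: real assume "e > 0"
  then obtain v where v: "norm (u - T 1 v) < e / 4"
    using range_T_dense[OF assms, of "e / 4"] by auto
  have "\<forall>\<^sub>F t in at_right 0. 0 < t \<and> t * norm (T 1 v - v) < e / 2"
    using \<open>e > 0\<close> by (intro small_multiple) auto
  then show "\<forall>\<^sub>F t in at_right 0. dist (P t u) u < e"
  proof eventually_elim
    case (elim t)
    then show ?case using v P_diff_id_le[of t u v] assms by (simp add: dist_norm)
  qed
qed

lemma P_quotient_tendsto:
  assumes "0 < l" "u \<in> X"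
  shows "((\<lambda>h. (P h (T l u) - T l u) /\<^sub>R h) \<longlongrightarrow> l *\<^sub>R T l u - u) (at_right 0)"
proof (rule tendstoI)
  fix e :: real assume "e > 0"
  let ?w = "l *\<^sub>R T l u - u"
  have "?w \<in> X" using subspace invariant[OF assms] assms(2) by (simp add: subspace_diff subspace_scale)
  \<comment> \<open>Here \<open>v\<close> is fixed before \<open>h\<close>: the approximation error
    stays below \<open>e / 2\<close> after doubling, and the remaining term vanishes with
    \<open>h\<close>.\<close>
  then obtain v where v: "norm (?w - T 1 v) < e / 4"
    using range_T_dense[of ?w "e / 4"] \<open>e > 0\<close> by auto
  have "\<forall>\<^sub>F h in at_right 0. 0 < h \<and> h * norm (T 1 v - v) < e / 2"
    using \<open>e > 0\<close> by (intro small_multiple) auto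
  then show "\<forall>\<^sub>F h in at_right 0. dist ((P h (T l u) - T l u) /\<^sub>R h) ?w < e"
  proof eventually_elim
    case (elim h)
    have "norm (x /\<^sub>R h - w) = norm (x - h *\<^sub>R w) / h" for x w :: 'a
    proof -
      have "x /\<^sub>R h - w = (x - h *\<^sub>R w) /\<^sub>R h"
        using elim by (simp add: scaleR_right_diff_distrib)
      then show ?thesis using elim by (simp only: norm_scaleR) (simp add: field_simps)
    qed
    then have "dist ((P h (T l u) - T l u) /\<^sub>R h) ?w = norm (P h (T l u) - T l u - h *\<^sub>R ?w) / h"
      by (simp only: dist_norm)
    also have "\<dots> \<le> 2 * norm (?w - T 1 v) + h * norm (T 1 v - v)"
      using elim P_quotient_le[of h l u v] assms by (simp only: pos_divide_le_eq mult.commute[of _ h])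
        simp
    also have "\<dots> < e" using elim v by simp
    finally show ?case .
  qed
qed

section \<open>The generator and its resolvent\<close>

lemma generator_P: "0 < l \<Longrightarrow> u \<in> X \<Longrightarrow> generator P (T l u) = l *\<^sub>R T l u - u"
  unfolding generator_def by (rule tendsto_Lim[OF _ P_quotient_tendsto]) auto

text \<open>The generator of a contraction semigroup cannot have the eigenvalue 1:
  \<open>P h z\<close> would be \<open>(1 + h) *\<^sub>R z\<close> up to o(h), which is longer than
  \<open>z\<close> unless \<open>z = 0\<close>.\<close>

lemma contraction_eigenvector_eq_0:
  assumes z: "z \<in> X" and lim: "((\<lambda>h. (P h z - z) /\<^sub>R h) \<longlongrightarrow> z) (at_right 0)"
  shows "z = 0"
proof -
  have "((\<lambda>h. norm ((P h z - z) /\<^sub>R h - z)) \<longlongrightarrow> norm (z - z)) (at_right 0)"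
    by (intro tendsto_intros lim)
  moreover have "\<forall>\<^sub>F h in at_right 0. norm z \<le> norm ((P h z - z) /\<^sub>R h - z)"
  proof (rule eventually_at_rightI[of 0 1])
    fix h :: real assume h: "h \<in> {0<..<1}"
    have "P h z - z - h *\<^sub>R z = P h z - (1 + h) *\<^sub>R z" by (simp add: algebra_simps)
    then have "norm (P h z - z - h *\<^sub>R z) \<ge> norm ((1 + h) *\<^sub>R z) - norm (P h z)"
      by (metis norm_minus_commute norm_triangle_ineq2)
    moreover have "norm (P h z) \<le> norm z" using h z by (intro norm_P) auto
    moreover have "norm ((1 + h) *\<^sub>R z) = norm z + h * norm z" using h by (simp add: distrib_right)
    ultimately have "h * norm z \<le> norm (P h z - z - h *\<^sub>R z)" by linarith
    also have "P h z - z - h *\<^sub>R z = h *\<^sub>R ((P h z - z) /\<^sub>R h - z)"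
      using h by (simp add: scaleR_right_diff_distrib)
    finally show "norm z \<le> norm ((P h z - z) /\<^sub>R h - z)" using h by simp
  qed simp
  ultimately have "norm z \<le> norm (z - z)"
    by (intro tendsto_lowerbound) auto
  then show ?thesis by simp
qed

lemma generator_domain_P:
  assumes "0 < l"
  shows "generator_domain X P = T l ` X"
proof
  have sub: "T l ` X \<subseteq> generator_domain X P" if "0 < l" for l
  proof
    fix u assume "u \<in> T l ` X"
    then obtain v where v: "v \<in> X" "u = T l v" by blast
    then have "l *\<^sub>R u - v \<in> X"
      using subspace invariant[OF that v(1)] by (simp add: subspace_diff subspace_scale)
    then show "u \<in> generator_domain X P"
      using P_quotient_tendsto[OF that v(1)] invariant[OF that v(1)] v
      by (auto simp: generator_domain_def)
  qed
  then show "T l ` X \<subseteq> generator_domain X P" using assms by blast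
  show "generator_domain X P \<subseteq> T l ` X"
  proof
    fix u assume "u \<in> generator_domain X P"
    then obtain w where uw: "u \<in> X" "w \<in> X" "((\<lambda>h. (P h u - u) /\<^sub>R h) \<longlongrightarrow> w) (at_right 0)"
      by (auto simp: generator_domain_def)
    \<comment> \<open>If \<open>u\<close> were \<open>T 1 x\<close>, its generator value
      \<open>w\<close> would be \<open>u - x\<close>, which forces \<open>x = u - w\<close>. The
      difference \<open>u - ?v\<close> then has itself as generator value, so it vanishes.\<close>
    let ?v = "T 1 (u - w)"
    have "u - w \<in> X" using subspace uw by (simp add: subspace_diff)
    then have v: "?v \<in> X" "((\<lambda>h. (P h ?v - ?v) /\<^sub>R h) \<longlongrightarrow> 1 *\<^sub>R ?v - (u - w)) (at_right 0)"
      by (simp_all only: invariant P_quotient_tendsto zero_less_one)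
    have "((\<lambda>h. (P h (u - ?v) - (u - ?v)) /\<^sub>R h) \<longlongrightarrow> u - ?v) (at_right 0)"
    proof (rule Lim_transform_eventually)
      show "((\<lambda>h. (P h u - u) /\<^sub>R h - (P h ?v - ?v) /\<^sub>R h) \<longlongrightarrow> u - ?v) (at_right 0)"
        using tendsto_diff[OF uw(3) v(2)] by simp
      show "\<forall>\<^sub>F h in at_right 0. (P h u - u) /\<^sub>R h - (P h ?v - ?v) /\<^sub>R h
          = (P h (u - ?v) - (u - ?v)) /\<^sub>R h"
        by (rule eventually_at_rightI[of 0 1])
          (use uw v in \<open>auto simp: P_diff_vector scaleR_right_diff_distrib\<close>)
    qed
    then have "u - ?v = 0"
      using subspace uw v by (intro contraction_eigenvector_eq_0) (auto simp: subspace_diff)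
    then have "u \<in> T 1 ` X" using \<open>u - w \<in> X\<close> by simp
    then show "u \<in> T l ` X" using range_T_eq[OF assms, of 1] by simp
  qed
qed

text \<open>The map recovers \<open>v\<close> from \<open>T l v\<close>. Injectivity of
  \<open>T l\<close> on \<open>X\<close> is a consequence, not an assumption.\<close>

lemma bij_betw_generator:
  assumes "0 < l"
  shows "bij_betw (\<lambda>u. l *\<^sub>R u - generator P u) (generator_domain X P) X"
  unfolding generator_domain_P[OF assms] bij_betw_def
  by (auto simp: inj_on_def generator_P[OF assms] image_image)

lemma resolvent_generator:
  assumes "0 < l" "u \<in> X"
  shows "resolvent (generator_domain X P) (generator P) l u = T l u"
  unfolding resolvent_def
  by (rule inv_into_f_eq[OF bij_betw_imp_inj_on[OF bij_betw_generator[OF assms(1)]]])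
    (use assms in \<open>auto simp: generator_domain_P[OF assms(1)] generator_P\<close>)

lemma in_resolvent_set_generator:
  assumes "0 < l"
  shows "l \<in> resolvent_set X (generator_domain X P) (generator P)"
proof -
  have "bounded_operator X (resolvent (generator_domain X P) (generator P) l)"
    unfolding bounded_operator_def linear_operator_def
    using subspace norm_blinfun[of "T l"]
    by (auto simp: resolvent_generator[OF assms] subspace_add subspace_scale blinfun.bilinear_simps)
  then show ?thesis
    by (simp add: resolvent_set_def bij_betw_generator[OF assms])
qed

lemma c0_semigroup_P: "c0_semigroup X P"
proof -
  have "bounded_operator X (P t)" if "0 \<le> t" for t
    unfolding bounded_operator_def linear_operator_def
    using subspace that norm_P[OF that]
    by (auto simp: P_add_vector P_scaleR intro!: exI[of _ 1])
  then show ?thesis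
    unfolding c0_semigroup_def
    using subspace closed by (auto simp: P_in_X P_0 P_semigroup P_tendsto_id)
qed

end

section \<open>Preliminaries on lattices, resolvents and double series\<close>

text \<open>The lattice norm makes the absolute value continuous, so a limit of nonnegative vectors
  equals its own absolute value.\<close>

lemma closed_nonneg_cone: "closed {x::'a::banach_lattice. 0 \<le> x}"
  unfolding closed_sequential_limits
proof (intro allI impI, elim conjE)
  fix x l assume x: "\<forall>n. x n \<in> {x::'a. 0 \<le> x}" and lim: "x \<longlonglongrightarrow> l"
  have "\<bar>x n - \<bar>l\<bar>\<bar> \<le> \<bar>x n - l\<bar>" for n
  proof -
    have "\<bar>x n\<bar> = x n" using x by (intro abs_of_nonneg) auto
    then show ?thesis using abs_triangle_ineq3[of "x n" l] by (simp only:)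
  qed
  then have "norm (x n - \<bar>l\<bar>) \<le> norm (x n - l)" for n
    by (rule norm_abs_mono)
  then have "\<forall>\<^sub>F n in sequentially. norm (x n - \<bar>l\<bar>) \<le> norm (x n - l)"
    by (rule always_eventually[OF allI])
  then have "(\<lambda>n. x n - \<bar>l\<bar>) \<longlonglongrightarrow> 0"
    by (rule Lim_null_comparison[OF _ tendsto_norm_zero[OF LIM_zero[OF lim]]])
  then have "x \<longlonglongrightarrow> \<bar>l\<bar>" by (rule LIM_zero_cancel)
  with lim have "l = \<bar>l\<bar>" by (rule LIMSEQ_unique)
  then have "0 \<le> l" by (rule ssubst) (rule abs_ge_zero)
  then show "l \<in> {x. 0 \<le> x}" by simp
qed

text \<open>Positivity of \<open>f\<close> at |u| - u and at |u| + u gives |f u| \<le> f |u|. Norm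
  bounds therefore only have to be checked on the positive cone, with the same constant.\<close>

lemma positive_linear_norm_le_norm_abs:
  fixes f :: "'a::banach_lattice \<Rightarrow> 'b::banach_lattice"
  assumes f: "linear f" and pos: "\<And>u. 0 \<le> u \<Longrightarrow> 0 \<le> f u"
  shows "norm (f u) \<le> norm (f \<bar>u\<bar>)"
proof (rule norm_abs_mono)
  have "0 \<le> \<bar>u\<bar> - u" "0 \<le> \<bar>u\<bar> - (- u)"
    using abs_ge_self[of u] abs_ge_minus_self[of u] by (simp_all only: diff_ge_0_iff_ge)
  then have "0 \<le> f \<bar>u\<bar> - f u" "0 \<le> f \<bar>u\<bar> - (- f u)"
    using pos[of "\<bar>u\<bar> - u"] pos[of "\<bar>u\<bar> - (- u)"]
    by (simp_all only: linear_diff[OF f] linear_neg[OF f])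
  then have "f u \<le> f \<bar>u\<bar>" "- f u \<le> f \<bar>u\<bar>"
    by (simp_all only: diff_ge_0_iff_ge)
  then have "\<bar>f u\<bar> \<le> f \<bar>u\<bar>" by (rule abs_leI)
  then show "\<bar>f u\<bar> \<le> \<bar>f \<bar>u\<bar>\<bar>" using abs_ge_self order_trans by blast
qed

lemma positive_linear_norm_le:
  fixes f :: "'a::banach_lattice \<Rightarrow> 'b::banach_lattice"
  assumes f: "linear f" and pos: "\<And>u. 0 \<le> u \<Longrightarrow> 0 \<le> f u"
    and bound: "\<And>u. 0 \<le> u \<Longrightarrow> norm (f u) \<le> c * norm u"
  shows "norm (f u) \<le> c * norm u"
  using positive_linear_norm_le_norm_abs[OF f pos, of u] bound[of "\<bar>u\<bar>"]
  by (simp add: banach_lattice_norm_abs)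

lemma subspace_closure:
  fixes D :: "'a::real_normed_vector set"
  assumes "subspace D"
  shows "subspace (closure D)"
proof (rule subspaceI)
  show "0 \<in> closure D" using closure_subset subspace_0[OF assms] by blast
  show "x + y \<in> closure D" if xy: "x \<in> closure D" "y \<in> closure D" for x y
  proof -
    obtain f g where fg: "\<forall>n. f n \<in> D" "f \<longlonglongrightarrow> x" "\<forall>n. g n \<in> D" "g \<longlonglongrightarrow> y"
      using xy unfolding closure_sequential by metis
    then show ?thesis
      unfolding closure_sequential using tendsto_add[OF fg(2,4)] subspace_add[OF assms]
      by (intro exI[of _ "\<lambda>n. f n + g n"]) simp
  qed
  show "c *\<^sub>R x \<in> closure D" if x: "x \<in> closure D" for c x
  proof -
    obtain f where f: "\<forall>n. f n \<in> D" "f \<longlonglongrightarrow> x"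
      using x unfolding closure_sequential by metis
    then show ?thesis
      unfolding closure_sequential using tendsto_scaleR[OF tendsto_const f(2)] subspace_scale[OF assms]
      by (intro exI[of _ "\<lambda>n. c *\<^sub>R f n"]) simp
  qed
qed

lemma resolvent_in_domain: "bij_betw (\<lambda>u. l *\<^sub>R u - A u) D UNIV \<Longrightarrow> resolvent D A l u \<in> D"
  unfolding resolvent_def by (auto simp: bij_betw_def intro: inv_into_into)

lemma resolvent_right_inverse:
  "bij_betw (\<lambda>u. l *\<^sub>R u - A u) D UNIV \<Longrightarrow> l *\<^sub>R resolvent D A l u - A (resolvent D A l u) = u"
  unfolding resolvent_def by (rule bij_betw_inv_into_right) auto

lemma resolvent_left_inverse:
  "bij_betw (\<lambda>u. l *\<^sub>R u - A u) D X \<Longrightarrow> u \<in> D \<Longrightarrow> resolvent D A l (l *\<^sub>R u - A u) = u"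
  unfolding resolvent_def by (rule bij_betw_inv_into_left)

lemma resolvent_linear:
  assumes A: "linear_operator D A" and bij: "bij_betw (\<lambda>u. l *\<^sub>R u - A u) D UNIV"
  shows "linear (resolvent D A l)"
proof (rule linearI)
  let ?R = "resolvent D A l"
  note inD = resolvent_in_domain[OF bij] and right = resolvent_right_inverse[OF bij]
  show "?R (u + v) = ?R u + ?R v" for u v
  proof -
    have "l *\<^sub>R (?R u + ?R v) - A (?R u + ?R v) = (l *\<^sub>R ?R u - A (?R u)) + (l *\<^sub>R ?R v - A (?R v))"
      using A inD by (simp add: linear_operator_def algebra_simps)
    moreover have "?R u + ?R v \<in> D" using A inD by (simp add: linear_operator_def subspace_add)
    ultimately show ?thesis using resolvent_left_inverse[OF bij] right by metis
  qed
  show "?R (c *\<^sub>R u) = c *\<^sub>R ?R u" for c u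
  proof -
    have "l *\<^sub>R (c *\<^sub>R ?R u) - A (c *\<^sub>R ?R u) = c *\<^sub>R (l *\<^sub>R ?R u - A (?R u))"
      using A inD by (simp add: linear_operator_def algebra_simps)
    moreover have "c *\<^sub>R ?R u \<in> D" using A inD by (simp add: linear_operator_def subspace_scale)
    ultimately show ?thesis using resolvent_left_inverse[OF bij] right by metis
  qed
qed

text \<open>A Cauchy product for operators that are composed rather than multiplied: the absolutely
  summable double family is regrouped along antidiagonals.\<close>

lemma sums_triangle:
  fixes g :: "nat \<Rightarrow> nat \<Rightarrow> 'a::banach"
  assumes row: "\<And>j. summable (\<lambda>k. norm (g k j))" and sum: "summable (\<lambda>j. \<Sum>k. norm (g k j))"
  shows "(\<lambda>n. \<Sum>k\<le>n. g k (n - k)) sums (\<Sum>j. \<Sum>k. g k j)"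
proof -
  let ?f = "\<lambda>(j, k). g k j"
  have infsum_suminf: "infsum h UNIV = suminf h" "h summable_on UNIV"
    if "summable (\<lambda>n. norm (h n))" for h :: "nat \<Rightarrow> 'b::banach"
    using norm_summable_imp_has_sum[OF that summable_sums[OF summable_norm_cancel[OF that]]]
    by (auto simp: infsumI has_sum_imp_summable)
  have "(\<lambda>p. norm (?f p)) summable_on UNIV \<times> UNIV"
  proof (rule Infinite_Sum.abs_summable_on_Sigma_iff[where f = ?f, THEN iffD2], intro conjI ballI)
    show "(\<lambda>k. norm (?f (j, k))) summable_on UNIV" for j
      using infsum_suminf(2)[of "\<lambda>k. norm (g k j)"] row by simp
    have "(\<Sum>\<^sub>\<infinity>k. norm (?f (j, k))) = (\<Sum>k. norm (g k j))" for j
      using infsum_suminf(1)[of "\<lambda>k. norm (g k j)"] row by simp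
    moreover have "(\<lambda>j. norm (\<Sum>k. norm (g k j))) summable_on UNIV"
      using infsum_suminf(2)[of "\<lambda>j. norm (\<Sum>k. norm (g k j))"] sum
      by (simp add: suminf_nonneg row)
    ultimately show "(\<lambda>j. norm (\<Sum>\<^sub>\<infinity>k. norm (?f (j, k)))) summable_on UNIV" by simp
  qed
  then have sm: "?f summable_on UNIV \<times> UNIV"
    by (rule abs_summable_summable)
  have "infsum ?f (UNIV \<times> UNIV) = (\<Sum>\<^sub>\<infinity>j. \<Sum>\<^sub>\<infinity>k. g k j)"
    using infsum_Sigma_banach[OF sm] by simp
  also have "\<dots> = (\<Sum>\<^sub>\<infinity>j. \<Sum>k. g k j)"
    by (intro infsum_cong infsum_suminf(1) row)
  also have "\<dots> = (\<Sum>j. \<Sum>k. g k j)"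
  proof (rule infsum_suminf(1), rule summable_comparison_test[OF _ sum])
    show "\<exists>N. \<forall>j\<ge>N. norm (norm (\<Sum>k. g k j)) \<le> (\<Sum>k. norm (g k j))"
      using summable_norm[OF row] by simp
  qed
  finally have "(?f has_sum (\<Sum>j. \<Sum>k. g k j)) (UNIV \<times> UNIV)"
    using sm has_sum_infsum by metis
  \<comment> \<open>The natural subtraction is harmless because the source only contains pairs with
    \<open>k \<le> n\<close>.\<close>
  moreover have "bij_betw (\<lambda>(n, k). (n - k, k)) (Sigma (UNIV :: nat set) (\<lambda>n. {..n})) (UNIV \<times> UNIV)"
    by (rule bij_betwI[where g = "\<lambda>(j, k). (j + k, k)"]) auto
  ultimately have "((\<lambda>(n, k). g k (n - k)) has_sum (\<Sum>j. \<Sum>k. g k j)) (Sigma UNIV (\<lambda>n. {..n}))"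
    using has_sum_reindex_bij_betw[where f = ?f] by (fastforce simp: case_prod_unfold)
  from has_sum_SigmaD[OF this, of "\<lambda>n. \<Sum>k\<le>n. g k (n - k)"]
  have "((\<lambda>n. \<Sum>k\<le>n. g k (n - k)) has_sum (\<Sum>j. \<Sum>k. g k j)) UNIV"
    by (auto intro: has_sum_finite)
  then show ?thesis by (rule has_sum_imp_sums)
qed

section \<open>The perturbation series\<close>

locale substochastic_perturbation =
  fixes A B :: "'a::al_space \<Rightarrow> 'a" and D :: "'a set"
  assumes linear_A: "linear_operator D A" and res_pos: "resolvent_positive D A"
    and linear_B: "linear_operator D B" and pos_B: "positive_operator D B"
    and dissipative: "\<And>u. u \<in> D \<Longrightarrow> 0 \<le> u \<Longrightarrow> al_functional (A u + B u) \<le> 0"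
begin

section \<open>Resolvent of the unperturbed operator\<close>

abbreviation R :: "real \<Rightarrow> 'a \<Rightarrow> 'a" where
  "R \<equiv> resolvent D A"

lemma subspace_D: "subspace D"
  using linear_A by (simp add: linear_operator_def)

lemma B_nonneg: "u \<in> D \<Longrightarrow> 0 \<le> u \<Longrightarrow> 0 \<le> B u"
  using pos_B by (simp add: positive_operator_def)

text \<open>The only use of dissipativity. On the positive cone the norm is the linear
  \<open>al_functional\<close>, so the sign condition turns into an inequality between norms. It
  yields both the bound \<open>1 / l\<close> for the resolvent and the telescoping of the Neumann
  terms.\<close>

lemma norm_B_le:
  assumes "u \<in> D" "0 \<le> u" "0 \<le> l *\<^sub>R u - A u"
  shows "norm (B u) + l * norm u \<le> norm (l *\<^sub>R u - A u)"
proof -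
  interpret al: bounded_linear "al_functional :: 'a \<Rightarrow> real" by (rule bounded_linear_al_functional)
  have "norm (l *\<^sub>R u - A u) = l * al_functional u - al_functional (A u)"
    using assms(3) by (simp add: al.diff al.scaleR flip: al_functional_eq_norm)
  moreover have "al_functional (B u) = norm (B u)" "al_functional u = norm u"
    using assms B_nonneg by (simp_all add: al_functional_eq_norm)
  ultimately show ?thesis using dissipative[OF assms(1,2)] by (simp add: al.add)
qed

text \<open>Resolvent positivity is only given beyond some \<open>w\<close>. For smaller
  \<open>m\<close> the equation \<open>m *\<^sub>R v - A v = f\<close> is rewritten at a large
  \<open>l\<close> as the fixed point problem \<open>v = R l (f + (l - m) *\<^sub>R v)\<close>, a
  contraction with factor \<open>(l - m) / l\<close> by the bound \<open>1 / l\<close>.\<close>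

lemma bij_and_positive:
  assumes "0 < m"
  shows "bij_betw (\<lambda>u. m *\<^sub>R u - A u) D UNIV"
    and "0 \<le> u \<Longrightarrow> 0 \<le> R m u"
proof -
  obtain w where w: "{w<..} \<subseteq> resolvent_set UNIV D A"
      "\<And>l. l > w \<Longrightarrow> positive_operator UNIV (R l)"
    using res_pos by (auto simp: resolvent_positive_def)
  define l where "l = max w m + 1"
  have l: "l > w" "l > m" "l > 0" using assms by (auto simp: l_def)
  have bij: "bij_betw (\<lambda>u. l *\<^sub>R u - A u) D UNIV"
    using w(1) l by (auto simp: resolvent_set_def)
  have pos: "0 \<le> R l u" if "0 \<le> u" for u
    using w(2)[OF l(1)] that by (simp add: positive_operator_def)
  note lin = resolvent_linear[OF linear_A bij]
  have bound: "norm (R l u) \<le> (1 / l) * norm u" for u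
  proof (rule positive_linear_norm_le[OF lin pos])
    fix u :: 'a assume "0 \<le> u"
    then have "norm (B (R l u)) + l * norm (R l u) \<le> norm u"
      using norm_B_le[OF resolvent_in_domain[OF bij] pos, of u l]
      by (simp add: resolvent_right_inverse[OF bij])
    then have "l * norm (R l u) \<le> norm u" using norm_ge_zero[of "B (R l u)"] by linarith
    then show "norm (R l u) \<le> (1 / l) * norm u" using l by (simp add: field_simps)
  qed
  have fixed_iff: "R l (f + (l - m) *\<^sub>R v) = v \<longleftrightarrow> v \<in> D \<and> m *\<^sub>R v - A v = f" for f v
  proof
    assume v: "R l (f + (l - m) *\<^sub>R v) = v"
    then show "v \<in> D \<and> m *\<^sub>R v - A v = f"
      using resolvent_in_domain[OF bij, of "f + (l - m) *\<^sub>R v"]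
        resolvent_right_inverse[OF bij, of "f + (l - m) *\<^sub>R v"]
      by (simp add: algebra_simps)
  next
    assume v: "v \<in> D \<and> m *\<^sub>R v - A v = f"
    then have "f + (l - m) *\<^sub>R v = l *\<^sub>R v - A v" by (auto simp: algebra_simps)
    then show "R l (f + (l - m) *\<^sub>R v) = v"
      using resolvent_left_inverse[OF bij] v by simp
  qed
  \<comment> \<open>The invariant set \<open>C\<close> will be the whole space for bijectivity and
    the positive cone for positivity.\<close>
  have fixed: "\<exists>!v. v \<in> C \<and> v \<in> D \<and> m *\<^sub>R v - A v = f"
    if C: "closed C" "C \<noteq> {}" "\<And>v. v \<in> C \<Longrightarrow> R l (f + (l - m) *\<^sub>R v) \<in> C" for C f
  proof -
    have "\<exists>!v. v \<in> C \<and> R l (f + (l - m) *\<^sub>R v) = v"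
    proof (rule Banach_fix[where c = "(l - m) / l"])
      show "complete C" using C by (simp add: complete_eq_closed)
      show "0 \<le> (l - m) / l" "(l - m) / l < 1" using l assms by auto
      fix x y assume "x \<in> C" "y \<in> C"
      have "R l (f + (l - m) *\<^sub>R x) - R l (f + (l - m) *\<^sub>R y) = (l - m) *\<^sub>R R l (x - y)"
        by (simp add: linear_add[OF lin] linear_diff[OF lin] linear_scale[OF lin] algebra_simps)
      then show "dist (R l (f + (l - m) *\<^sub>R x)) (R l (f + (l - m) *\<^sub>R y)) \<le> (l - m) / l * dist x y"
        using mult_left_mono[OF bound[of "x - y"], of "l - m"] l by (simp add: dist_norm)
    qed (use C in auto)
    then show ?thesis by (simp add: fixed_iff)
  qed
  show bij_m: "bij_betw (\<lambda>u. m *\<^sub>R u - A u) D UNIV"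
    unfolding bij_betw_iff_bijections
  proof -
    have ex: "\<exists>!v. v \<in> D \<and> m *\<^sub>R v - A v = f" for f
      using fixed[of UNIV f] by simp
    then show "\<exists>g. (\<forall>x\<in>D. m *\<^sub>R x - A x \<in> UNIV \<and> g (m *\<^sub>R x - A x) = x) \<and>
        (\<forall>y\<in>UNIV. g y \<in> D \<and> m *\<^sub>R g y - A (g y) = y)"
      using ex[THEN theI'] ex[THEN the1_equality]
      by (intro exI[of _ "\<lambda>f. THE v. v \<in> D \<and> m *\<^sub>R v - A v = f"]) simp
  qed
  show "0 \<le> R m u" if u: "0 \<le> u" for u
  proof -
    have "\<exists>!v. v \<in> {v. 0 \<le> v} \<and> v \<in> D \<and> m *\<^sub>R v - A v = u"
    proof (rule fixed)
      show "closed {v::'a. 0 \<le> v}" by (rule closed_nonneg_cone)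
      show "R l (u + (l - m) *\<^sub>R v) \<in> {v. 0 \<le> v}" if "v \<in> {v. 0 \<le> v}" for v
        using pos[of "u + (l - m) *\<^sub>R v"] u that l by (simp add: scaleR_nonneg_nonneg)
    qed auto
    then obtain v where "0 \<le> v" "v \<in> D" "m *\<^sub>R v - A v = u" by auto
    then show ?thesis using resolvent_left_inverse[OF bij_m] by auto
  qed
qed

lemma R_in_D: "0 < l \<Longrightarrow> R l u \<in> D"
  by (rule resolvent_in_domain[OF bij_and_positive(1)])

lemma R_right: "0 < l \<Longrightarrow> l *\<^sub>R R l u - A (R l u) = u"
  by (rule resolvent_right_inverse[OF bij_and_positive(1)])

lemma R_left: "0 < l \<Longrightarrow> u \<in> D \<Longrightarrow> R l (l *\<^sub>R u - A u) = u"
  by (rule resolvent_left_inverse[OF bij_and_positive(1)])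

lemma linear_R: "0 < l \<Longrightarrow> linear (R l)"
  by (rule resolvent_linear[OF linear_A bij_and_positive(1)])

lemma norm_BR_le:
  assumes "0 < l" "0 \<le> u"
  shows "norm (B (R l u)) + l * norm (R l u) \<le> norm u"
  using norm_B_le[OF R_in_D bij_and_positive(2), of l u l] assms by (simp add: R_right)

lemma R_diff:
  assumes "0 < l" "0 < m"
  shows "R l u - R m u = (m - l) *\<^sub>R R l (R m u)"
proof -
  have "l *\<^sub>R R m u - A (R m u) = (l - m) *\<^sub>R R m u + u"
    using R_right[OF assms(2), of u] by (simp add: algebra_simps)
  then have "R m u = (l - m) *\<^sub>R R l (R m u) + R l u"
    using R_left[OF assms(1) R_in_D[OF assms(2)], of u] linear_R[OF assms(1)]
    by (simp add: linear_add linear_scale)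
  then show ?thesis by (simp add: algebra_simps)
qed

section \<open>Neumann terms and their sum\<close>

definition C :: "real \<Rightarrow> 'a \<Rightarrow> 'a" where
  "C l = (\<lambda>v. B (R l v))"

definition K :: "nat \<Rightarrow> real \<Rightarrow> 'a \<Rightarrow> 'a" where
  "K n l u = R l ((C l ^^ n) u)"

lemma linear_C: "0 < l \<Longrightarrow> linear (C l)"
  using linear_B R_in_D linear_R
  by (intro linearI) (simp_all add: C_def linear_operator_def linear_add linear_scale)

lemma linear_C_power: "0 < l \<Longrightarrow> linear (C l ^^ n)"
proof (induction n)
  case 0
  show ?case by (simp add: linear_ident)
next
  case (Suc n)
  then show ?case using linear_compose[of "C l ^^ n" "C l"] linear_C by (simp add: o_def)
qed

lemma linear_K: "0 < l \<Longrightarrow> linear (K n l)"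
  using linear_compose[OF linear_C_power linear_R, of l l n] by (simp add: K_def[abs_def] o_def)

lemma C_power_nonneg: "0 < l \<Longrightarrow> 0 \<le> u \<Longrightarrow> 0 \<le> (C l ^^ n) u"
  by (induction n) (simp_all add: C_def B_nonneg R_in_D bij_and_positive(2))

lemma K_nonneg: "0 < l \<Longrightarrow> 0 \<le> u \<Longrightarrow> 0 \<le> K n l u"
  by (simp add: K_def bij_and_positive(2) C_power_nonneg)

lemma K_0: "K 0 l u = R l u"
  by (simp add: K_def)

text \<open>Splitting off the innermost factor, not the outermost one, is what the induction on
  resolvent differences and the index shift in the left inverse need.\<close>

lemma K_Suc: "K (Suc n) l u = K n l (C l u)"
  by (simp add: K_def funpow_Suc_right del: funpow.simps)

lemma K_in_D: "0 < l \<Longrightarrow> K n l u \<in> D"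
  by (simp add: K_def R_in_D)

lemma sum_norm_K_le:
  assumes l: "0 < l"
  shows "(\<Sum>n<N. norm (K n l u)) \<le> norm u / l"
proof -
  \<comment> \<open>The remainder \<open>norm ((C l ^^ N) v)\<close> is kept on the left so that the
    induction closes; it is dropped afterwards.\<close>
  have nonneg: "l * (\<Sum>n<N. norm (K n l v)) + norm ((C l ^^ N) v) \<le> norm v" if "0 \<le> v" for v
  proof (induction N)
    case (Suc N)
    have "norm ((C l ^^ Suc N) v) + l * norm (K N l v) \<le> norm ((C l ^^ N) v)"
      using norm_BR_le[OF l C_power_nonneg[OF l that]] by (simp add: K_def C_def)
    with Suc show ?case by (simp add: algebra_simps)
  qed simp
  have "(\<Sum>n<N. norm (K n l u)) \<le> (\<Sum>n<N. norm (K n l \<bar>u\<bar>))"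
    by (intro sum_mono positive_linear_norm_le_norm_abs linear_K K_nonneg l)
  also have "\<dots> \<le> norm \<bar>u\<bar> / l"
  proof -
    have "l * (\<Sum>n<N. norm (K n l \<bar>u\<bar>)) \<le> norm \<bar>u\<bar>"
      using nonneg[OF abs_ge_zero[of u]] norm_ge_zero[of "(C l ^^ N) \<bar>u\<bar>"] by linarith
    then show ?thesis using l by (simp add: pos_le_divide_eq mult.commute)
  qed
  finally show ?thesis by (simp add: banach_lattice_norm_abs)
qed

lemma summable_norm_K: "0 < l \<Longrightarrow> summable (\<lambda>n. norm (K n l u))"
  by (rule summableI_nonneg_bounded[of _ "norm u / l"]) (auto intro: sum_norm_K_le)

lemma summable_K: "0 < l \<Longrightarrow> summable (\<lambda>n. K n l u)"
  by (rule summable_norm_cancel[OF summable_norm_K])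

lemma suminf_norm_K_le: "0 < l \<Longrightarrow> (\<Sum>n. norm (K n l u)) \<le> norm u / l"
  by (rule suminf_le_const[OF summable_norm_K sum_norm_K_le])

definition S :: "real \<Rightarrow> 'a \<Rightarrow> 'a" where
  "S l u = (\<Sum>n. K n l u)"

lemma norm_S_le: "0 < l \<Longrightarrow> norm (S l u) \<le> norm u / l"
  unfolding S_def using summable_norm[OF summable_norm_K] suminf_norm_K_le order_trans by blast

lemma bounded_linear_S: "0 < l \<Longrightarrow> bounded_linear (S l)"
  using norm_S_le[of l]
  by (intro bounded_linear_intro[of _ "1 / l"])
    (simp_all add: S_def linear_add[OF linear_K] linear_scale[OF linear_K] suminf_add[symmetric]
      summable_K suminf_scaleR_right[symmetric])

lemma S_in_closed:
  assumes l: "0 < l" and X: "closed X" "0 \<in> X" "\<And>v w. v \<in> X \<Longrightarrow> w \<in> X \<Longrightarrow> v + w \<in> X"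
    and K: "\<And>n. K n l u \<in> X"
  shows "S l u \<in> X"
proof -
  have "(\<Sum>n<N. K n l u) \<in> X" for N
    by (induction N) (simp_all add: X K)
  then show ?thesis
    unfolding S_def using closed_sequentially[OF X(1) _ summable_LIMSEQ[OF summable_K[OF l]]]
    by blast
qed

text \<open>With R(l, A + rB) expanded formally as the sum of r^n \<open>K n l\<close>, this is the
  coefficient of r^n in the resolvent equation. The induction needs no r: passing through
  \<open>K n l (C m u)\<close> separates a change of the innermost factor from the induction
  hypothesis at \<open>C m u\<close>.\<close>

lemma K_diff:
  assumes l: "0 < l" and m: "0 < m"
  shows "K n l u - K n m u = (m - l) *\<^sub>R (\<Sum>k\<le>n. K k l (K (n - k) m u))"
proof (induction n arbitrary: u)
  case 0
  show ?case by (simp add: K_0 R_diff[OF l m])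
next
  case (Suc n)
  have "C l u - C m u = (m - l) *\<^sub>R C l (R m u)"
  proof -
    have "R l u = R m u + (m - l) *\<^sub>R R l (R m u)"
      unfolding R_diff[OF l m, symmetric] by (simp only: add_diff_cancel_left' diff_add_cancel add_diff_eq)
    then have "C l u = B (R m u + (m - l) *\<^sub>R R l (R m u))"
      by (simp only: C_def)
    also have "\<dots> = C m u + (m - l) *\<^sub>R C l (R m u)"
      using linear_B R_in_D[OF l] R_in_D[OF m] subspace_D
      by (simp add: C_def linear_operator_def subspace_scale)
    finally show ?thesis by simp
  qed
  \<comment> \<open>This is the summand \<open>k = Suc n\<close> of the new convolution; the
    induction hypothesis supplies the summands \<open>k \<le> n\<close>.\<close>
  then have "K n l (C l u) - K n l (C m u) = (m - l) *\<^sub>R K (Suc n) l (K 0 m u)"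
    by (simp add: K_Suc K_0 linear_diff[OF linear_K[OF l], symmetric] linear_scale[OF linear_K[OF l]])
  moreover have "K n l (C m u) - K n m (C m u) = (m - l) *\<^sub>R (\<Sum>k\<le>n. K k l (K (Suc n - k) m u))"
    unfolding Suc.IH by (simp add: Suc_diff_le K_Suc)
  ultimately have "(K n l (C m u) - K n m (C m u)) + (K n l (C l u) - K n l (C m u))
      = (m - l) *\<^sub>R (\<Sum>k\<le>Suc n. K k l (K (Suc n - k) m u))"
    by (simp only: scaleR_add_right[symmetric] sum.atMost_Suc diff_self_eq_0)
  moreover have "K (Suc n) l u - K (Suc n) m u
      = (K n l (C m u) - K n m (C m u)) + (K n l (C l u) - K n l (C m u))"
    by (simp add: K_Suc)
  ultimately show ?case by simp
qed

text \<open>Summing \<open>K_diff\<close> over \<open>n\<close> is legitimate because the inner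
  norms add up to at most \<open>norm (K j m u) / l\<close>, which is summable in
  \<open>j\<close>.\<close>

lemma S_resolvent_eq:
  assumes l: "0 < l" and m: "0 < m"
  shows "S l u - S m u = (m - l) *\<^sub>R S l (S m u)"
proof -
  have "(\<lambda>n. \<Sum>k\<le>n. K k l (K (n - k) m u)) sums (\<Sum>j. \<Sum>k. K k l (K j m u))"
  proof (rule sums_triangle)
    show "summable (\<lambda>k. norm (K k l (K j m u)))" for j by (rule summable_norm_K[OF l])
    show "summable (\<lambda>j. \<Sum>k. norm (K k l (K j m u)))"
    proof (rule summable_comparison_test)
      show "summable (\<lambda>j. norm (K j m u) / l)"
        by (intro summable_divide summable_norm_K m)
      show "\<exists>N. \<forall>j\<ge>N. norm (\<Sum>k. norm (K k l (K j m u))) \<le> norm (K j m u) / l"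
        using suminf_norm_K_le[OF l] by (auto simp: suminf_nonneg summable_norm_K[OF l])
    qed
  qed
  moreover have "(\<Sum>j. \<Sum>k. K k l (K j m u)) = S l (S m u)"
    using bounded_linear.suminf[OF bounded_linear_S[OF l] summable_K[OF m, of u]]
    by (simp add: S_def)
  ultimately have "(\<lambda>n. (m - l) *\<^sub>R (\<Sum>k\<le>n. K k l (K (n - k) m u))) sums ((m - l) *\<^sub>R S l (S m u))"
    by (auto intro: sums_scaleR_right)
  then have "(\<lambda>n. K n l u - K n m u) sums ((m - l) *\<^sub>R S l (S m u))"
    by (simp add: K_diff[OF l m])
  moreover have "(\<lambda>n. K n l u - K n m u) sums (S l u - S m u)"
    unfolding S_def by (intro sums_diff summable_sums summable_K l m)
  ultimately show ?thesis using sums_unique2 by metis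
qed

text \<open>An index shift: since \<open>R l (l *\<^sub>R u - A u) = u\<close>, the terms from index
  1 on of the series at \<open>l *\<^sub>R u - A u\<close> are the series at \<open>B u\<close>, and
  the term at 0 is \<open>u\<close>.\<close>

lemma S_left_inverse:
  assumes l: "0 < l" and u: "u \<in> D"
  shows "S l (l *\<^sub>R u - (A u + B u)) = u"
proof -
  interpret S: bounded_linear "S l" by (rule bounded_linear_S[OF l])
  have "S l (l *\<^sub>R u - A u) = (\<Sum>n. K (Suc n) l (l *\<^sub>R u - A u)) + K 0 l (l *\<^sub>R u - A u)"
    unfolding S_def using suminf_split_head[OF summable_K[OF l, of "l *\<^sub>R u - A u"]] by simp
  also have "\<dots> = S l (B u) + u"
    by (simp add: K_Suc K_0 C_def S_def R_left[OF l u])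
  finally show ?thesis
    by (simp add: S.diff S.add diff_diff_eq[symmetric])
qed

text \<open>For \<open>v\<close> in \<open>D\<close> the left inverse property makes the error equal
  to \<open>S l (A v + B v)\<close>, of norm at most \<open>norm (A v + B v) / l\<close>;
  contractivity extends the convergence to the closure.\<close>

lemma S_approx:
  assumes "u \<in> closure D"
  shows "(\<lambda>n. real (Suc n) *\<^sub>R S (Suc n) u) \<longlonglongrightarrow> u"
proof (rule LIMSEQ_I)
  fix e :: real assume "e > 0"
  then obtain v where v: "v \<in> D" "norm (u - v) < e / 4"
    using assms closure_approachable[of u D] by (auto simp: dist_norm norm_minus_commute dest: spec[of _ "e / 4"])
  let ?c = "norm (A v + B v)"
  obtain N where N: "?c / (e / 4) < real N" using reals_Archimedean2 by blast
  have "norm (real (Suc n) *\<^sub>R S (Suc n) u - u) < e" if "n \<ge> N" for n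
  proof -
    let ?l = "real (Suc n)"
    interpret S: bounded_linear "S ?l" by (rule bounded_linear_S) simp
    have "?l *\<^sub>R S ?l v - S ?l (A v + B v) = v"
      using S_left_inverse[of ?l v] v(1) by (simp only: S.diff S.scaleR of_nat_0_less_iff zero_less_Suc)
    then have "?l *\<^sub>R S ?l v - v = S ?l (A v + B v)"
      by (simp only: diff_eq_eq) (simp only: add.commute add_diff_cancel_left')
    then have "norm (?l *\<^sub>R S ?l v - v) \<le> ?c / ?l"
      using norm_S_le[of ?l] by simp
    moreover have "?c / ?l < e / 4"
    proof -
      have "?c / (e / 4) < ?l" using N that by linarith
      then show ?thesis using \<open>e > 0\<close> by (simp add: field_simps del: of_nat_Suc)
    qed
    moreover have "norm (?l *\<^sub>R S ?l (u - v)) \<le> norm (u - v)"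
      using norm_S_le[of ?l "u - v"] by (simp add: pos_le_divide_eq mult.commute del: of_nat_Suc)
    moreover have "?l *\<^sub>R S ?l u - u = ?l *\<^sub>R S ?l (u - v) + (?l *\<^sub>R S ?l v - v) - (u - v)"
      by (simp add: S.diff scaleR_right_diff_distrib del: of_nat_Suc)
    then have "norm (?l *\<^sub>R S ?l u - u)
        \<le> norm (?l *\<^sub>R S ?l (u - v)) + norm (?l *\<^sub>R S ?l v - v) + norm (u - v)"
      by (simp only: norm_add_diff_triangle)
    ultimately show ?thesis using v(2) \<open>e > 0\<close> by linarith
  qed
  then show "\<exists>N. \<forall>n\<ge>N. norm (real (Suc n) *\<^sub>R S (Suc n) u - u) < e" by blast
qed

section \<open>The semigroup on the closure of the domain\<close>

definition T :: "real \<Rightarrow> 'a \<Rightarrow>\<^sub>L 'a" where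
  "T l = Blinfun (S l)"

lemma T_apply: "0 < l \<Longrightarrow> blinfun_apply (T l) = S l"
  unfolding T_def by (rule bounded_linear_Blinfun_apply[OF bounded_linear_S])

sublocale T: contraction_resolvent T "closure D"
proof
  show "norm (l *\<^sub>R T l) \<le> 1" if "0 < l" for l
    using norm_S_le[OF that] that
    by (intro norm_blinfun_bound) (auto simp: blinfun.scaleR_left T_apply field_simps)
  show "T l - T m = (m - l) *\<^sub>R (T l o\<^sub>L T m)" if "0 < l" "0 < m" for l m
    using S_resolvent_eq[OF that] that by (intro blinfun_eqI) (simp add: blinfun.bilinear_simps T_apply)
  show "T l u \<in> closure D" if "0 < l" for l u
    unfolding T_apply[OF that]
    using subspace_closure[OF subspace_D] K_in_D[OF that] closure_subset
    by (intro S_in_closed[OF that]) (auto simp: subspace_0 subspace_add)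
  show "(\<lambda>n. real (Suc n) *\<^sub>R T (Suc n) u) \<longlonglongrightarrow> u" if "u \<in> closure D" for u
    using S_approx[OF that] by (simp add: T_apply)
qed (simp_all add: subspace_D subspace_closure)

lemma substochastic_semigroup_P: "substochastic_semigroup (closure D) T.P"
proof -
  have "0 \<le> T.P t u" if "0 \<le> t" "u \<in> closure D" "0 \<le> u" for t u
  proof -
    have "T.P t u \<in> {u. 0 \<le> u}"
    proof (rule T.P_in_cone)
      show "T l v \<in> {u. 0 \<le> u}" if "0 < l" "v \<in> {u. 0 \<le> u}" for l v
        unfolding T_apply[OF that(1)]
        by (rule S_in_closed[OF that(1) closed_nonneg_cone]) (use K_nonneg that in auto)
    qed (use that closed_nonneg_cone in \<open>auto simp: scaleR_nonneg_nonneg\<close>)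
    then show ?thesis by simp
  qed
  then show ?thesis
    by (simp add: substochastic_semigroup_def positive_operator_def T.c0_semigroup_P T.norm_P)
qed

text \<open>Membership in the part domain puts \<open>v = u - (A u + B u)\<close> into the closure
  of \<open>D\<close>. Then \<open>u = T 1 v\<close>, and the generator sends \<open>u\<close> to
  \<open>u - v\<close>.\<close>

lemma generator_extends:
  assumes "u \<in> part_domain (closure D) D (\<lambda>u. A u + B u)"
  shows "u \<in> generator_domain (closure D) T.P" and "generator T.P u = A u + B u"
proof -
  define v where "v = 1 *\<^sub>R u - (A u + B u)"
  have u: "u \<in> D" "A u + B u \<in> closure D" using assms by (auto simp: part_domain_def)
  then have v: "v \<in> closure D" unfolding v_def
    using closure_subset subspace_D by (intro subspace_diff) (auto simp: subspace_closure)
  have eq: "u = T 1 v" using S_left_inverse[OF zero_less_one u(1)] by (simp add: T_apply v_def)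
  show "u \<in> generator_domain (closure D) T.P"
    using eq v by (simp add: T.generator_domain_P[of 1])
  show "generator T.P u = A u + B u"
    using T.generator_P[OF zero_less_one v] eq[symmetric] by (simp add: v_def)
qed

lemma in_resolvent_set_A:
  assumes l: "0 < l"
  shows "l \<in> resolvent_set UNIV D A"
proof -
  \<comment> \<open>The partial sum with the single term \<open>K 0 l u\<close> is
    \<open>R l u\<close>.\<close>
  have "norm (R l u) \<le> (1 / l) * norm u" for u
    using sum_norm_K_le[OF l, where N = 1 and u = u] by (simp add: K_0)
  then have "bounded_operator UNIV (R l)"
    unfolding bounded_operator_def linear_operator_def
    using linear_R[OF l] by (auto simp: linear_add linear_scale intro!: exI[of _ "1 / l"])
  then show ?thesis by (simp add: resolvent_set_def bij_and_positive(1)[OF l])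
qed

lemma resolvent_generator_series:
  assumes "0 < l" "u \<in> closure D"
  shows "(\<lambda>N. \<Sum>n=0..N. R l (((\<lambda>v. B (R l v)) ^^ n) u))
    \<longlonglongrightarrow> resolvent (generator_domain (closure D) T.P) (generator T.P) l u"
proof -
  have "(\<lambda>N. \<Sum>n\<le>N. K n l u) \<longlonglongrightarrow> S l u"
    unfolding S_def by (rule summable_LIMSEQ'[OF summable_K[OF assms(1)]])
  then show ?thesis
    by (simp add: T.resolvent_generator[OF assms] T_apply[OF assms(1)] K_def C_def atLeast0AtMost)
qed

end

theorem theorem2p1:
  fixes A B :: "'a::al_space \<Rightarrow> 'a" and D :: "'a set"
  assumes "linear_operator D A" and "resolvent_positive D A"
    and "linear_operator D B" and "positive_operator D B"
    and "\<And>u. u \<in> D \<Longrightarrow> 0 \<le> u \<Longrightarrow> al_functional (A u + B u) \<le> 0"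
  shows "\<exists>P. substochastic_semigroup (closure D) P \<and>
    part_domain (closure D) D (\<lambda>u. A u + B u) \<subseteq> generator_domain (closure D) P \<and>
    (\<forall>u \<in> part_domain (closure D) D (\<lambda>u. A u + B u). generator P u = A u + B u) \<and>
    (\<forall>l>0. l \<in> resolvent_set UNIV D A \<and>
      l \<in> resolvent_set (closure D) (generator_domain (closure D) P) (generator P) \<and>
      (\<forall>u \<in> closure D.
        (\<lambda>N. \<Sum>n=0..N. resolvent D A l (((\<lambda>v. B (resolvent D A l v)) ^^ n) u))
          \<longlonglongrightarrow> resolvent (generator_domain (closure D) P) (generator P) l u))"
proof -
  interpret substochastic_perturbation A B D
    using assms by unfold_locales
  show ?thesis
    using substochastic_semigroup_P generator_extends in_resolvent_set_A
      T.in_resolvent_set_generator resolvent_generator_series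
    by (intro exI[of _ T.P]) auto
qed

end
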